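(* Let $\Xi$, $\mathcal X$, $A(\cdot)$, $b(\cdot)$, $c(\cdot)$ and the lifted data $\bar S,\bar t,\bar A(\cdot),\bar b(\cdot)$ (with dimensions $J'$, $K'$) be as in the context, with $\Xi$ nonempty and bounded. Then the robust quadratic program $$\inf_{x\in\mathcal X}\ \sup_{\xi\in\Xi}\ \|A(x)\xi\|^2+b(x)^\top\xi+c(x)$$ is equivalent to the copositive program $$\begin{array}{cl}\inf & c(x)+\bar t^\top\psi+(\bar t\circ\bar t)^\top\phi+\tau\\ \text{s.t.}& x\in\mathcal X,\ \tau\in\mathbb R,\ \psi,\phi\in\mathbb R^{J'},\ \gamma\in\mathbb R^{LQ},\ H\in\mathbb S_+^{K'},\\ & \begin{bmatrix}\mathbb I&\bar A(x)\\ \bar A(x)^\top&H\end{bmatrix}\succeq 0,\\ & \begin{bmatrix}\bar S^\top\operatorname{diag}(\phi)\bar S-H-\operatorname{diag}\left([\gamma^\top\ 0^\top]^\top\right)&\frac12\left(\bar S^\top\psi-\bar b(x)+[\gamma^\top\ 0^\top]^\top\right)\\ \frac12\left(\bar S^\top\psi-\bar b(x)+[\gamma^\top\ 0^\top]^\top\right)^\top&\tau\end{bmatrix}\succeq_{\mathcal C}0.\end{array}$$ That is, for every fixed $x\in\mathcal X$ the infimum of the copositive program over the remaining variables $(\tau,\psi,\phi,\gamma,H)$ equals $\sup_{\xi\in\Xi}\|A(x)\xi\|^2+b(x)^\top\xi+c(x)$, so that the two problems have the same optimal value.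
   Context: Problem data. $\mathcal X\subseteq\mathbb R^D$ is a polytope; $A:\mathcal X\to\mathbb R^{M\times K}$ and $b:\mathcal X\to\mathbb R^K$ are affine; $c:\mathcal X\to\mathbb R$ is a convex quadratic function. The uncertainty set is $\Xi=\{\xi\in\mathbb R_+^K: S\xi=t,\ \xi_\ell\in\mathbb Z\ \forall \ell\in[L]\}$ with $S\in\mathbb R^{J\times K}$, $t\in\mathbb R^J$, $0\le L\le K$, $[L]=\{1,\dots,L\}$. $\Xi$ is bounded, and $Q\in\mathbb Z_+$ is a fixed integer such that $\xi_\ell\in\{0,\dots,2^Q-1\}$ for all $\xi\in\Xi$ and $\ell\in[L]$. Lifted data. Let $v_Q=[2^0\ 2^1\ \cdots\ 2^{Q-1}]^\top$, $J'=LQ+J+L$, $K'=2LQ+K$. A vector of $\mathbb R^{K'}$ is partitioned as $\xi'=[\chi_1^\top\cdots\chi_L^\top\ \eta_1^\top\cdots\eta_L^\top\ \xi^\top]^\top$ with $\chi_\ell,\eta_\ell\in\mathbb R^Q$, $\xi\in\mathbb R^K$. The matrix $\bar S\in\mathbb R^{J'\times K'}$ and vector $\bar t\in\mathbb R^{J'}$ are those for which $\bar S\xi'=\bar t$ is, in this row order, the system: $S\xi=t$; $\xi_\ell-v_Q^\top\chi_\ell=0$ for $\ell=1,\dots,L$; $\chi_\ell+\eta_\ell=\mathbf e$ (all-ones vector) for $\ell=1,\dots,L$. In block form, $$\bar S=\begin{bmatrix}0&0&S\\ -\mathbb I_L\otimes v_Q^\top&0&[\mathbb I_L\ 0]\\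 \mathbb I_{LQ}&\mathbb I_{LQ}&0\end{bmatrix},\qquad \bar t=\begin{bmatrix}t\\0\\ \mathbf e\end{bmatrix}.$$ Further $\bar A(x)=[0\ \ 0\ \ A(x)]\in\mathbb R^{M\times K'}$ and $\bar b(x)=[0^\top\ 0^\top\ b(x)^\top]^\top\in\mathbb R^{K'}$. Notation. $\mathbb S^n$ ($\mathbb S^n_+$): symmetric (positive semidefinite) $n\times n$ matrices. $\mathcal C$: copositive matrices, i.e. $N\in\mathbb S^n$ with $z^\top Nz\ge0$ for all $z\ge0$; $N\succeq_{\mathcal C}0$ means $N\in\mathcal C$; $N\succeq 0$ means positive semidefinite. $\circ$ is the entrywise product, $\|\cdot\|$ the Euclidean norm. $[\gamma^\top\ 0^\top]^\top\in\mathbb R^{K'}$ is $\gamma\in\mathbb R^{LQ}$ padded with zeros; $\operatorname{diag}$ of a vector is the corresponding diagonal matrix. *)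

theory Defs
  imports "HOL-Analysis.Analysis" "Jordan_Normal_Form.Matrix"
begin

(* Matrices and vectors whose sizes are natural numbers (possibly 0) are those of
   Jordan_Normal_Form; HOL-Analysis is used for the space R^D of the decision x.  The two
   libraries share the infix symbols below, which from here on mean vec_index and scalar_prod. *)

no_notation vec_nth (infixl "$" 90)
no_notation inner (infix "\<bullet>" 70)

definition norm_vec :: "real vec \<Rightarrow> real" where
  "norm_vec v = sqrt (v \<bullet> v)"

definition ones_vec :: "nat \<Rightarrow> real vec" where
  "ones_vec n = Matrix.vec n (\<lambda>_. 1)"

definition hadamard_vec :: "real vec \<Rightarrow> real vec \<Rightarrow> real vec" where
  "hadamard_vec u v = Matrix.vec (dim_vec u) (\<lambda>i. u $ i * v $ i)"

definition diag_of_vec :: "real vec \<Rightarrow> real mat" where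
  "diag_of_vec v = mat_diag (dim_vec v) (\<lambda>i. v $ i)"

definition append_cols :: "real mat \<Rightarrow> real mat \<Rightarrow> real mat" (infixr "@\<^sub>c" 66) where
  "A @\<^sub>c B = four_block_mat A B (0\<^sub>m 0 (dim_col A)) (0\<^sub>m 0 (dim_col B))"

definition kronecker :: "real mat \<Rightarrow> real mat \<Rightarrow> real mat" where
  "kronecker A B = Matrix.mat (dim_row A * dim_row B) (dim_col A * dim_col B)
     (\<lambda>(i, j). A $$ (i div dim_row B, j div dim_col B) * B $$ (i mod dim_row B, j mod dim_col B))"

definition psd_mat :: "nat \<Rightarrow> real mat \<Rightarrow> bool" where
  "psd_mat n N \<longleftrightarrow> N \<in> carrier_mat n n \<and> transpose_mat N = N \<and>
     (\<forall>z \<in> carrier_vec n. 0 \<le> z \<bullet> (N *\<^sub>v z))"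

definition copositive_mat :: "nat \<Rightarrow> real mat \<Rightarrow> bool" where
  "copositive_mat n N \<longleftrightarrow> N \<in> carrier_mat n n \<and> transpose_mat N = N \<and>
     (\<forall>z \<in> carrier_vec n. (\<forall>i<n. 0 \<le> z $ i) \<longrightarrow> 0 \<le> z \<bullet> (N *\<^sub>v z))"

definition affine_fun_on :: "(real^'d) set \<Rightarrow> (real^'d \<Rightarrow> real) \<Rightarrow> bool" where
  "affine_fun_on X f \<longleftrightarrow> (\<exists>g r. linear g \<and> (\<forall>x\<in>X. f x = g x + r))"

definition affine_mat_on :: "(real^'d) set \<Rightarrow> nat \<Rightarrow> nat \<Rightarrow> (real^'d \<Rightarrow> real mat) \<Rightarrow> bool" where
  "affine_mat_on X m n A \<longleftrightarrow> (\<forall>x\<in>X. A x \<in> carrier_mat m n) \<and>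
     (\<forall>i<m. \<forall>j<n. affine_fun_on X (\<lambda>x. A x $$ (i, j)))"

definition affine_vec_on :: "(real^'d) set \<Rightarrow> nat \<Rightarrow> (real^'d \<Rightarrow> real vec) \<Rightarrow> bool" where
  "affine_vec_on X n b \<longleftrightarrow> (\<forall>x\<in>X. b x \<in> carrier_vec n) \<and>
     (\<forall>i<n. affine_fun_on X (\<lambda>x. b x $ i))"

definition quadratic_fun_on :: "(real^'d) set \<Rightarrow> (real^'d \<Rightarrow> real) \<Rightarrow> bool" where
  "quadratic_fun_on X c \<longleftrightarrow>
     (\<exists>(P :: real^'d^'d) p r. \<forall>x\<in>X. c x = inner x (P *v x) + inner p x + r)"

(* Coordinates are numbered from 0, so the integer coordinates are those with index l < L. *)
definition uncertainty_set :: "nat \<Rightarrow> nat \<Rightarrow> real mat \<Rightarrow> real vec \<Rightarrow> real vec set" where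
  "uncertainty_set K L S t =
     {\<xi> \<in> carrier_vec K. (\<forall>i<K. 0 \<le> \<xi> $ i) \<and> S *\<^sub>v \<xi> = t \<and> (\<forall>l<L. \<xi> $ l \<in> \<int>)}"

definition robust_objective :: "real mat \<Rightarrow> real vec \<Rightarrow> real \<Rightarrow> real vec \<Rightarrow> real" where
  "robust_objective Ax bx cx \<xi> = (norm_vec (Ax *\<^sub>v \<xi>))\<^sup>2 + bx \<bullet> \<xi> + cx"

definition pow2_vec :: "nat \<Rightarrow> real vec" where
  "pow2_vec Q = Matrix.vec Q (\<lambda>q. 2 ^ q)"

(* Lifted vectors are chi @v eta @v xi with chi, eta of length L*Q, where entry l*Q + q of chi is
   the q-th binary digit of xi $ l.  The three block rows encode  S xi = t,
   xi $ l = (SUM q<Q. 2^q * chi $ (l*Q + q))  and  chi + eta = e. *)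
definition lift_S :: "nat \<Rightarrow> nat \<Rightarrow> nat \<Rightarrow> nat \<Rightarrow> real mat \<Rightarrow> real mat" where
  "lift_S J K L Q S =
     (0\<^sub>m J (L*Q) @\<^sub>c 0\<^sub>m J (L*Q) @\<^sub>c S) @\<^sub>r
     (- kronecker (1\<^sub>m L) (mat_of_row (pow2_vec Q)) @\<^sub>c 0\<^sub>m L (L*Q) @\<^sub>c (1\<^sub>m L @\<^sub>c 0\<^sub>m L (K - L))) @\<^sub>r
     (1\<^sub>m (L*Q) @\<^sub>c 1\<^sub>m (L*Q) @\<^sub>c 0\<^sub>m (L*Q) K)"

definition lift_t :: "nat \<Rightarrow> nat \<Rightarrow> real vec \<Rightarrow> real vec" where
  "lift_t L Q t = t @\<^sub>v 0\<^sub>v L @\<^sub>v ones_vec (L*Q)"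

definition lift_A :: "nat \<Rightarrow> nat \<Rightarrow> nat \<Rightarrow> real mat \<Rightarrow> real mat" where
  "lift_A M L Q Ax = 0\<^sub>m M (L*Q) @\<^sub>c 0\<^sub>m M (L*Q) @\<^sub>c Ax"

definition lift_b :: "nat \<Rightarrow> nat \<Rightarrow> real vec \<Rightarrow> real vec" where
  "lift_b L Q bx = 0\<^sub>v (L*Q) @\<^sub>v 0\<^sub>v (L*Q) @\<^sub>v bx"

type_synonym cop_vars = "real \<times> real vec \<times> real vec \<times> real vec \<times> real mat"

definition cop_feasible ::
  "nat \<Rightarrow> nat \<Rightarrow> nat \<Rightarrow> nat \<Rightarrow> nat \<Rightarrow> real mat \<Rightarrow> real mat \<Rightarrow> real vec \<Rightarrow> cop_vars set" where
  "cop_feasible J K L M Q S Ax bx =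
    (let J' = L*Q + J + L;
         K' = 2*L*Q + K;
         Sb = lift_S J K L Q S;
         Ab = lift_A M L Q Ax;
         bb = lift_b L Q bx
     in {(\<tau>, \<psi>, \<phi>, \<gamma>, H).
          \<psi> \<in> carrier_vec J' \<and> \<phi> \<in> carrier_vec J' \<and> \<gamma> \<in> carrier_vec (L*Q) \<and> psd_mat K' H \<and>
          psd_mat (M + K') (four_block_mat (1\<^sub>m M) Ab (transpose_mat Ab) H) \<and>
          (let \<gamma>0 = \<gamma> @\<^sub>v 0\<^sub>v (L*Q + K);
               u = (1/2) \<cdot>\<^sub>v (transpose_mat Sb *\<^sub>v \<psi> - bb + \<gamma>0)
           in copositive_mat (K' + 1)
                (four_block_mat
                  (transpose_mat Sb * diag_of_vec \<phi> * Sb - H - diag_of_vec \<gamma>0)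
                  (transpose_mat (mat_of_row u))
                  (mat_of_row u)
                  (Matrix.mat 1 1 (\<lambda>_. \<tau>))))})"

fun cop_objective :: "nat \<Rightarrow> nat \<Rightarrow> real vec \<Rightarrow> real \<Rightarrow> cop_vars \<Rightarrow> real" where
  "cop_objective L Q t cx (\<tau>, \<psi>, \<phi>, \<gamma>, H) =
     cx + lift_t L Q t \<bullet> \<psi> + hadamard_vec (lift_t L Q t) (lift_t L Q t) \<bullet> \<phi> + \<tau>"

end

theory Submission
  imports Defs
begin

text \<open>
  For a point \<open>\<xi>\<close> of the uncertainty set, the binary expansions of its integer coordinates give a
  nonnegative \<open>z = (\<beta>, e - \<beta>, \<xi>)\<close> satisfying the lifted system, and evaluating the copositive
  form at \<open>(z, 1)\<close> gives weak duality.

  Conversely let \<open>v\<close> exceed the robust value. With \<open>\<phi> = \<rho> e\<close>, \<open>\<psi> = - 2 \<rho> t\<close>, \<open>\<gamma> = \<mu> e\<close>,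
  \<open>H = B\<^sup>T B\<close> and \<open>\<tau> = v - c + \<rho> |t|\<^sup>2\<close> (\<open>R\<close>, \<open>t\<close>, \<open>B\<close>, \<open>b\<close> being the lifted data) the objective
  is \<open>v\<close> and the form at \<open>(z, s)\<close> is
  \<open>(v - c) s\<^sup>2 - |B z|\<^sup>2 - s b\<^sup>T z + \<rho> |R z - s t|\<^sup>2 + \<mu> (\<Sum>i. z\<^sub>i (s - z\<^sub>i))\<close>, the last sum
  ranging over the digits. Being homogeneous, it need only be nonnegative on the standard simplex.
  On the simplex the two penalties vanish together only at positive multiples of lifted points of the
  uncertainty set (\<open>s = 0\<close> is excluded because the set is bounded), where the remaining terms are
  positive; compactness then yields first \<open>\<mu>\<close> and then \<open>\<rho>\<close>.
\<close>

subsection \<open>Penalties on the standard simplex\<close>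

text \<open>The sets where \<open>h + k * g\<close> is positive, for natural \<open>k\<close>, are
  relatively open and cover \<open>C\<close>. Since \<open>g\<close> is nonnegative they grow with
  \<open>k\<close>, so the largest index of a finite subcover serves all of
  \<open>C\<close>.\<close>

lemma penalty_on_compact:
  fixes h g :: "'a::t2_space \<Rightarrow> real"
  assumes C: "compact C" and h: "continuous_on C h" and g: "continuous_on C g"
    and g0: "\<And>x. x \<in> C \<Longrightarrow> 0 \<le> g x" and pos: "\<And>x. x \<in> C \<Longrightarrow> g x = 0 \<Longrightarrow> 0 < h x"
  shows "\<exists>m\<ge>0. \<forall>x\<in>C. 0 < h x + m * g x"
proof -
  have "\<exists>U. open U \<and> U \<inter> C = {x\<in>C. 0 < h x + real k * g x}" for k
  proof -
    have "continuous_on C (\<lambda>x. h x + real k * g x)"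
      by (intro continuous_intros h g)
    then obtain U where "open U" "U \<inter> C = (\<lambda>x. h x + real k * g x) -` {0<..} \<inter> C"
      unfolding continuous_on_open_invariant using open_greaterThan[of "0::real"] by metis
    then show ?thesis by (intro exI[of _ U]) auto
  qed
  then obtain U where U: "\<And>k. open (U k)" "\<And>k. U k \<inter> C = {x\<in>C. 0 < h x + real k * g x}"
    by metis
  have cover: "C \<subseteq> (\<Union>k. U k)"
  proof
    fix x assume x: "x \<in> C"
    obtain k :: nat where k: "0 < h x + real k * g x"
    proof (cases "g x = 0")
      case True
      then show ?thesis using pos[OF x] that[of 0] by simp
    next
      case False
      then have gp: "g x > 0" using g0[OF x] by simp
      obtain k :: nat where "- h x / g x < real k" using reals_Archimedean2 by blast
      then have "- h x < real k * g x" using pos_divide_less_eq[OF gp, of "- h x" "real k"] by simp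
      then show ?thesis using that[of k] by simp
    qed
    then have "x \<in> U k \<inter> C" using U(2) x by blast
    then show "x \<in> (\<Union>k. U k)" by blast
  qed
  obtain D where D: "finite D" "C \<subseteq> (\<Union>k\<in>D. U k)"
    using compactE_image[OF C, of UNIV U] U(1) cover by metis
  \<comment> \<open>Inserting 0 keeps \<open>Max\<close> defined for an empty subcover.\<close>
  define m where "m = real (Max (insert 0 D))"
  have "0 < h x + m * g x" if x: "x \<in> C" for x
  proof -
    obtain k where k: "k \<in> D" "x \<in> U k" using D x by blast
    then have "0 < h x + real k * g x" using U(2) x by blast
    moreover have "real k \<le> m" unfolding m_def using D(1) k(1) by simp
    then have "real k * g x \<le> m * g x" using g0[OF x] mult_right_mono by blast
    ultimately show ?thesis by linarith
  qed
  then show ?thesis by (intro exI[of _ m]) (auto simp: m_def)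
qed

text \<open>Points are functions on all of \<open>nat\<close> that vanish from \<open>n\<close> on:
  the dimension is a number and not a type, and the product topology on functions makes compactness
  available.\<close>

definition std_simplex :: "nat \<Rightarrow> (nat \<Rightarrow> real) set" where
  "std_simplex n = {w. (\<forall>i. 0 \<le> w i) \<and> (\<forall>i\<ge>n. w i = 0) \<and> (\<Sum>i<n. w i) = 1}"

text \<open>Tychonoff: the simplex is a closed slice of a product of intervals, which degenerate to
  a point from index \<open>n\<close> on.\<close>

lemma compact_std_simplex: "compact (std_simplex n)"
proof -
  let ?B = "PiE UNIV (\<lambda>i. if i < n then {0..1} else {0::real})"
  have "compact ?B"
    using compactin_PiE[of "\<lambda>_. euclidean :: real topology" UNIV "\<lambda>i. if i < n then {0..1} else {0::real}"]
    by (auto simp: euclidean_product_topology)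
  moreover have "closed {w :: nat \<Rightarrow> real. (\<Sum>i<n. w i) = 1}"
    by (intro closed_Collect_eq continuous_intros continuous_on_product_coordinates)
  ultimately have "compact (?B \<inter> {w. (\<Sum>i<n. w i) = 1})"
    by (rule compact_Int_closed)
  moreover have "std_simplex n = ?B \<inter> {w. (\<Sum>i<n. w i) = 1}"
  proof -
    have "w i \<le> 1" if "w \<in> std_simplex n" "i < n" for w i
    proof -
      have "w i \<le> (\<Sum>i<n. w i)"
        using that by (intro member_le_sum) (auto simp: std_simplex_def)
      then show ?thesis using that by (simp add: std_simplex_def)
    qed
    then have "std_simplex n \<subseteq> ?B \<inter> {w. (\<Sum>i<n. w i) = 1}"
      by (auto simp: std_simplex_def)
    moreover have "w \<in> std_simplex n" if "w \<in> ?B" "(\<Sum>i<n. w i) = 1" for w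
    proof -
      have "w i \<in> (if i < n then {0..1} else {0})" for i using that(1) by blast
      then have "0 \<le> w i \<and> (n \<le> i \<longrightarrow> w i = 0)" for i
        by (metis atLeastAtMost_iff linorder_not_less order_refl singletonD)
      then show ?thesis using that(2) by (simp add: std_simplex_def)
    qed
    ultimately show ?thesis by blast
  qed
  ultimately show ?thesis by simp
qed

lemma scalar_prod_vec_eq_sum:
  "u \<in> carrier_vec n \<Longrightarrow> u \<bullet> Matrix.vec n w = (\<Sum>i<n. u $ i * w i)"
  by (simp add: scalar_prod_def atLeast0LessThan)

lemma continuous_on_scalar_prod_vec:
  fixes u :: "real vec"
  assumes "u \<in> carrier_vec n"
  shows "continuous_on UNIV (\<lambda>w. u \<bullet> Matrix.vec n w)"
  unfolding scalar_prod_vec_eq_sum[OF assms]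
  by (intro continuous_intros continuous_on_product_coordinates)

lemma continuous_on_mult_mat_vec_index:
  fixes A :: "real mat"
  assumes "A \<in> carrier_mat m n" "j < m"
  shows "continuous_on UNIV (\<lambda>w. (A *\<^sub>v Matrix.vec n w) $ j)"
  using assms continuous_on_scalar_prod_vec[of "row A j" n] by simp

subsection \<open>Block matrices and quadratic forms\<close>

lemma scalar_prod_self_eq_sum: "v \<bullet> v = (\<Sum>i<dim_vec v. (v $ i)\<^sup>2)" for v :: "real vec"
  by (simp add: scalar_prod_def atLeast0LessThan power2_eq_square)

lemma scalar_prod_self_nonneg: "0 \<le> v \<bullet> v" for v :: "real vec"
  unfolding scalar_prod_self_eq_sum by (simp add: sum_nonneg)

lemma norm_vec_power2: "(norm_vec v)\<^sup>2 = v \<bullet> v"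
  by (simp add: norm_vec_def scalar_prod_self_nonneg)

lemma abs_index_le_norm_vec:
  assumes "i < dim_vec v"
  shows "\<bar>v $ i\<bar> \<le> norm_vec v"
proof -
  have "(v $ i)\<^sup>2 \<le> v \<bullet> v"
    unfolding scalar_prod_self_eq_sum using assms by (intro member_le_sum) auto
  then show ?thesis unfolding norm_vec_def by (simp add: real_le_rsqrt)
qed

lemma append_cols_carrier [simp, intro]:
  "A \<in> carrier_mat m n1 \<Longrightarrow> B \<in> carrier_mat m n2 \<Longrightarrow> A @\<^sub>c B \<in> carrier_mat m (n1 + n2)"
  unfolding append_cols_def by (intro carrier_matI) auto

text \<open>The lower blocks of \<open>append_cols\<close> have no rows, so the four-block product
  ends in an appended vector of dimension 0, which disappears.\<close>

lemma append_cols_mult_vec: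
  assumes "A \<in> carrier_mat m n1" "B \<in> carrier_mat m n2" "x \<in> carrier_vec n1" "y \<in> carrier_vec n2"
  shows "(A @\<^sub>c B) *\<^sub>v (x @\<^sub>v y) = A *\<^sub>v x + B *\<^sub>v y"
proof -
  have "(A @\<^sub>c B) *\<^sub>v (x @\<^sub>v y) =
      (A *\<^sub>v x + B *\<^sub>v y) @\<^sub>v (0\<^sub>m 0 n1 *\<^sub>v x + 0\<^sub>m 0 n2 *\<^sub>v y)"
    unfolding append_cols_def using assms
    by (subst four_block_mat_mult_vec[of A m n1 B n2 _ 0]) auto
  also have "\<dots> = A *\<^sub>v x + B *\<^sub>v y"
    using assms by (intro eq_vecI) auto
  finally show ?thesis .
qed

lemma zero_mat_mult_vec [simp]: "v \<in> carrier_vec n \<Longrightarrow> (0\<^sub>m m n :: real mat) *\<^sub>v v = 0\<^sub>v m"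
  by (intro eq_vecI) auto

lemma split_vec:
  assumes "z \<in> carrier_vec (m + n)"
  obtains x y where "x \<in> carrier_vec m" "y \<in> carrier_vec n" "z = x @\<^sub>v y"
  using vec_first_last_append[OF assms] vec_first_carrier[of z m] vec_last_carrier[of z n] by metis

lemma nonneg_append_iff:
  fixes x y :: "real vec"
  assumes "x \<in> carrier_vec m" "y \<in> carrier_vec n"
  shows "(\<forall>i<m + n. 0 \<le> (x @\<^sub>v y) $ i) \<longleftrightarrow> (\<forall>i<m. 0 \<le> x $ i) \<and> (\<forall>i<n. 0 \<le> y $ i)"
proof safe
  assume a: "\<forall>i<m + n. 0 \<le> (x @\<^sub>v y) $ i"
  { fix i assume "i < m" then show "0 \<le> x $ i" using a[rule_format, of i] assms by auto }
  { fix i assume "i < n" then show "0 \<le> y $ i" using a[rule_format, of "m + i"] assms by auto }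
qed (use assms in auto)

lemma diag_of_vec_carrier [simp]: "v \<in> carrier_vec n \<Longrightarrow> diag_of_vec v \<in> carrier_mat n n"
  by (auto simp: diag_of_vec_def)

lemma diag_of_vec_mult_vec:
  assumes "v \<in> carrier_vec n" "z \<in> carrier_vec n"
  shows "diag_of_vec v *\<^sub>v z = Matrix.vec n (\<lambda>i. v $ i * z $ i)"
proof (rule eq_vecI)
  fix i assume "i < dim_vec (Matrix.vec n (\<lambda>i. v $ i * z $ i))"
  then have i: "i < n" by simp
  have "(diag_of_vec v *\<^sub>v z) $ i = (\<Sum>j<n. (if i = j then v $ j else 0) * z $ j)"
    using assms i by (auto simp: diag_of_vec_def mat_diag_def scalar_prod_def atLeast0LessThan intro!: sum.cong)
  also have "\<dots> = v $ i * z $ i"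
    using i by (simp add: if_distrib[of "\<lambda>a. a * _"] cong: if_cong)
  finally show "(diag_of_vec v *\<^sub>v z) $ i = Matrix.vec n (\<lambda>i. v $ i * z $ i) $ i"
    using i by simp
qed (use assms in \<open>auto simp: diag_of_vec_def mat_diag_def\<close>)

lemma diag_of_vec_form:
  assumes "v \<in> carrier_vec n" "z \<in> carrier_vec n"
  shows "z \<bullet> (diag_of_vec v *\<^sub>v z) = (\<Sum>i<n. v $ i * (z $ i)\<^sup>2)"
  unfolding diag_of_vec_mult_vec[OF assms] scalar_prod_vec_eq_sum[OF assms(2)]
  by (simp add: power2_eq_square mult_ac)

lemma transpose_diag_of_vec: "transpose_mat (diag_of_vec v) = diag_of_vec v"
  unfolding diag_of_vec_def mat_diag_def by (intro eq_matI) auto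

text \<open>The scalar \<open>s\<close> enters as a vector of length 1. The two border blocks are
  transposes of each other and contribute the same term, hence the factor 2.\<close>

lemma block_form:
  fixes P :: "real mat"
  assumes P: "P \<in> carrier_mat n n" and u: "u \<in> carrier_vec n" and z: "z \<in> carrier_vec n"
  shows "(z @\<^sub>v Matrix.vec 1 (\<lambda>_. s)) \<bullet>
      (four_block_mat P (transpose_mat (mat_of_row u)) (mat_of_row u) (Matrix.mat 1 1 (\<lambda>_. \<tau>))
        *\<^sub>v (z @\<^sub>v Matrix.vec 1 (\<lambda>_. s)))
    = z \<bullet> (P *\<^sub>v z) + 2 * s * (u \<bullet> z) + \<tau> * s\<^sup>2" (is "(z @\<^sub>v ?s) \<bullet> (?N *\<^sub>v _) = _")
proof -
  let ?r = "mat_of_row u" and ?t = "Matrix.mat 1 1 (\<lambda>_. \<tau>) :: real mat"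
  have r: "?r \<in> carrier_mat 1 n" using u by (rule mat_of_row_carrier)
  have rz: "?r *\<^sub>v z = Matrix.vec 1 (\<lambda>_. u \<bullet> z)"
    using u z by (intro eq_vecI) auto
  have "?N *\<^sub>v (z @\<^sub>v ?s) = (P *\<^sub>v z + transpose_mat ?r *\<^sub>v ?s) @\<^sub>v (?r *\<^sub>v z + ?t *\<^sub>v ?s)"
    using P r z by (intro four_block_mat_mult_vec[of _ n n _ 1 _ 1]) auto
  moreover have "?r *\<^sub>v z + ?t *\<^sub>v ?s \<in> carrier_vec 1"
    by (rule carrier_vecI) simp
  then have "(z @\<^sub>v ?s) \<bullet> ((P *\<^sub>v z + transpose_mat ?r *\<^sub>v ?s) @\<^sub>v (?r *\<^sub>v z + ?t *\<^sub>v ?s)) =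
      z \<bullet> (P *\<^sub>v z + transpose_mat ?r *\<^sub>v ?s) + ?s \<bullet> (?r *\<^sub>v z + ?t *\<^sub>v ?s)"
    using P r z by (intro scalar_prod_append[of _ n _ 1]) auto
  moreover have "z \<bullet> (P *\<^sub>v z + transpose_mat ?r *\<^sub>v ?s)
      = z \<bullet> (P *\<^sub>v z) + z \<bullet> (transpose_mat ?r *\<^sub>v ?s)"
    using P r z by (intro scalar_prod_add_distrib[of _ n]) auto
  moreover have "z \<bullet> (transpose_mat ?r *\<^sub>v ?s) = ?s \<bullet> (?r *\<^sub>v z)"
    using transpose_vec_mult_scalar[OF r z, of ?s] comm_scalar_prod[of z n "transpose_mat ?r *\<^sub>v ?s"] r z
    by auto
  moreover have "?s \<bullet> (?r *\<^sub>v z) = s * (u \<bullet> z)"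
    unfolding rz by (simp add: scalar_prod_def)
  moreover have "?s \<bullet> (?r *\<^sub>v z + ?t *\<^sub>v ?s) = s * (u \<bullet> z) + \<tau> * s\<^sup>2"
    unfolding rz by (simp add: scalar_prod_def power2_eq_square algebra_simps)
  ultimately show ?thesis by simp
qed

lemma copositive_blockD:
  assumes "copositive_mat (n + 1)
      (four_block_mat P (transpose_mat (mat_of_row u)) (mat_of_row u) (Matrix.mat 1 1 (\<lambda>_. \<tau>)))"
    and "P \<in> carrier_mat n n" "u \<in> carrier_vec n" "z \<in> carrier_vec n"
    and "\<forall>i<n. 0 \<le> z $ i" "0 \<le> s"
  shows "0 \<le> z \<bullet> (P *\<^sub>v z) + 2 * s * (u \<bullet> z) + \<tau> * s\<^sup>2"
proof -
  have "z @\<^sub>v Matrix.vec 1 (\<lambda>_. s) \<in> carrier_vec (n + 1)"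
    using assms(4) by (intro append_carrier_vec) auto
  moreover have "\<forall>i<n + 1. 0 \<le> (z @\<^sub>v Matrix.vec 1 (\<lambda>_. s)) $ i"
    using assms(4-6) by (subst nonneg_append_iff) auto
  ultimately show ?thesis
    using assms(1) unfolding copositive_mat_def block_form[OF assms(2-4), symmetric] by blast
qed

text \<open>The form is homogeneous of degree 2, and a nonzero nonnegative vector is a positive
  multiple of a point of the simplex, so it is enough to check the form there. Coordinate
  \<open>n\<close> of \<open>w\<close> plays the part of the scalar \<open>s\<close> that belongs to
  the border.\<close>

lemma copositive_blockI:
  fixes P :: "real mat"
  assumes P: "P \<in> carrier_mat n n" and sym: "transpose_mat P = P" and u: "u \<in> carrier_vec n"
    and ge: "\<And>w. w \<in> std_simplex (n + 1) \<Longrightarrow>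
      0 \<le> Matrix.vec n w \<bullet> (P *\<^sub>v Matrix.vec n w) + 2 * w n * (u \<bullet> Matrix.vec n w) + \<tau> * (w n)\<^sup>2"
  shows "copositive_mat (n + 1)
      (four_block_mat P (transpose_mat (mat_of_row u)) (mat_of_row u) (Matrix.mat 1 1 (\<lambda>_. \<tau>)))"
    (is "copositive_mat _ ?N")
  unfolding copositive_mat_def
proof (intro conjI ballI impI)
  have r: "mat_of_row u \<in> carrier_mat 1 n" using u by (rule mat_of_row_carrier)
  show "?N \<in> carrier_mat (n + 1) (n + 1)" using P by auto
  have t1: "transpose_mat (Matrix.mat 1 1 (\<lambda>_. \<tau>)) = Matrix.mat 1 1 (\<lambda>_. \<tau>)"
    by (intro eq_matI) auto
  show "transpose_mat ?N = ?N"
    using P r by (subst transpose_four_block_mat[of _ n n _ 1 _ 1]) (auto simp: sym t1)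
  fix x :: "real vec" assume x: "x \<in> carrier_vec (n + 1)" and x0: "\<forall>i<n + 1. 0 \<le> x $ i"
  define \<sigma> where "\<sigma> = (\<Sum>i<n + 1. x $ i)"
  have \<sigma>0: "0 \<le> \<sigma>" unfolding \<sigma>_def using x0 by (intro sum_nonneg) auto
  show "0 \<le> x \<bullet> (?N *\<^sub>v x)"
  proof (cases "\<sigma> = 0")
    case True
    then have "\<forall>i<n + 1. x $ i = 0"
      unfolding \<sigma>_def using x0 by (subst (asm) sum_nonneg_eq_0_iff) auto
    then show ?thesis using x by (simp add: scalar_prod_def)
  next
    case False
    then have \<sigma>: "0 < \<sigma>" using \<sigma>0 by simp
    \<comment> \<open>Values from \<open>n + 1\<close> on are set to 0, as membership in
      \<open>std_simplex\<close> demands.\<close>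
    define w where "w = (\<lambda>i. if i < n + 1 then x $ i / \<sigma> else 0)"
    have "(\<Sum>i<n + 1. w i) = \<sigma> / \<sigma>"
      unfolding \<sigma>_def sum_divide_distrib by (intro sum.cong) (auto simp: w_def \<sigma>_def)
    then have w: "w \<in> std_simplex (n + 1)"
      using x0 \<sigma> unfolding std_simplex_def by (simp add: w_def)
    let ?y = "Matrix.vec n w @\<^sub>v Matrix.vec 1 (\<lambda>_. w n)"
    have y: "?y \<in> carrier_vec (n + 1)" by (intro append_carrier_vec) auto
    have N: "?N \<in> carrier_mat (n + 1) (n + 1)" using P by auto
    have xy: "x = \<sigma> \<cdot>\<^sub>v ?y"
      using x False by (intro eq_vecI) (auto simp: w_def less_Suc_eq)
    have "x \<bullet> (?N *\<^sub>v x) = \<sigma> * (\<sigma> * (?y \<bullet> (?N *\<^sub>v ?y)))"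
      using N y unfolding xy by (subst mult_mat_vec[OF N y]) simp
    moreover have "0 \<le> ?y \<bullet> (?N *\<^sub>v ?y)"
      using ge[OF w] P u by (subst block_form) auto
    ultimately show ?thesis using \<sigma> by simp
  qed
qed

text \<open>Moving \<open>transpose_mat R\<close> across the scalar product makes the first summand
  a sum of squares of the entries of \<open>R *\<^sub>v z\<close>, weighted by
  \<open>\<phi>\<close>. This is what lets a constant \<open>\<phi>\<close> act as a penalty on the
  residual.\<close>

lemma quadratic_part_form:
  fixes H :: "real mat"
  assumes R: "R \<in> carrier_mat m n" and H: "H \<in> carrier_mat n n"
    and \<phi>: "\<phi> \<in> carrier_vec m" and g: "g \<in> carrier_vec n" and z: "z \<in> carrier_vec n"
  shows "z \<bullet> ((transpose_mat R * diag_of_vec \<phi> * R - H - diag_of_vec g) *\<^sub>v z)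
    = (\<Sum>j<m. \<phi> $ j * ((R *\<^sub>v z) $ j)\<^sup>2) - z \<bullet> (H *\<^sub>v z) - (\<Sum>i<n. g $ i * (z $ i)\<^sup>2)"
proof -
  let ?D = "diag_of_vec \<phi>" and ?G = "diag_of_vec g"
  have D: "?D \<in> carrier_mat m m" and G: "?G \<in> carrier_mat n n" using \<phi> g by auto
  have T: "transpose_mat R * ?D * R \<in> carrier_mat n n" using R D by auto
  have Rz: "R *\<^sub>v z \<in> carrier_vec m" using R z by auto
  have "(transpose_mat R * ?D * R - H - ?G) *\<^sub>v z = (transpose_mat R * ?D * R) *\<^sub>v z - H *\<^sub>v z - ?G *\<^sub>v z"
    using T H G z minus_mult_distrib_mat_vec[of "transpose_mat R * ?D * R - H" n n ?G z]
      minus_mult_distrib_mat_vec[of "transpose_mat R * ?D * R" n n H z]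
    by (metis minus_carrier_mat)
  moreover have "(transpose_mat R * ?D * R) *\<^sub>v z = transpose_mat R *\<^sub>v (?D *\<^sub>v (R *\<^sub>v z))"
    using R D z Rz by (simp add: assoc_mult_mat_vec[of _ n m _ n] assoc_mult_mat_vec[of _ n m _ m])
  moreover have "z \<bullet> (transpose_mat R *\<^sub>v (?D *\<^sub>v (R *\<^sub>v z)) - H *\<^sub>v z - ?G *\<^sub>v z)
     = z \<bullet> (transpose_mat R *\<^sub>v (?D *\<^sub>v (R *\<^sub>v z))) - z \<bullet> (H *\<^sub>v z) - z \<bullet> (?G *\<^sub>v z)"
    using R D Rz H G z by (simp add: scalar_prod_minus_distrib[of _ n])
  moreover have "z \<bullet> (transpose_mat R *\<^sub>v (?D *\<^sub>v (R *\<^sub>v z))) = (R *\<^sub>v z) \<bullet> (?D *\<^sub>v (R *\<^sub>v z))"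
    using transpose_vec_mult_scalar[OF R z, of "?D *\<^sub>v (R *\<^sub>v z)"] D Rz R z
      comm_scalar_prod[of z n "transpose_mat R *\<^sub>v (?D *\<^sub>v (R *\<^sub>v z))"]
      comm_scalar_prod[of "R *\<^sub>v z" m "?D *\<^sub>v (R *\<^sub>v z)"] by auto
  ultimately show ?thesis
    using diag_of_vec_form[OF \<phi> Rz] diag_of_vec_form[OF g z] by simp
qed

lemma linear_part_form:
  fixes R :: "real mat"
  assumes R: "R \<in> carrier_mat m n" and \<psi>: "\<psi> \<in> carrier_vec m"
    and b: "b \<in> carrier_vec n" and g: "g \<in> carrier_vec n" and z: "z \<in> carrier_vec n"
  shows "((1/2) \<cdot>\<^sub>v (transpose_mat R *\<^sub>v \<psi> - b + g)) \<bullet> z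
    = (\<psi> \<bullet> (R *\<^sub>v z) - b \<bullet> z + g \<bullet> z) / 2"
proof -
  have "transpose_mat R *\<^sub>v \<psi> \<in> carrier_vec n" using R \<psi> by auto
  then show ?thesis
    using transpose_vec_mult_scalar[OF R z \<psi>] b g z
    by (simp add: add_scalar_prod_distrib[of _ n] minus_scalar_prod_distrib[of _ n])
qed

text \<open>Supplies the symmetry that \<open>copositive_mat\<close> asks for.\<close>

lemma transpose_quadratic_part:
  fixes H :: "real mat"
  assumes R: "R \<in> carrier_mat m n" and H: "H \<in> carrier_mat n n" "transpose_mat H = H"
    and \<phi>: "\<phi> \<in> carrier_vec m" and g: "g \<in> carrier_vec n"
  shows "transpose_mat (transpose_mat R * diag_of_vec \<phi> * R - H - diag_of_vec g)
    = transpose_mat R * diag_of_vec \<phi> * R - H - diag_of_vec g"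
proof -
  let ?D = "diag_of_vec \<phi>" and ?G = "diag_of_vec g"
  have D: "?D \<in> carrier_mat m m" and G: "?G \<in> carrier_mat n n" using \<phi> g by auto
  have T: "transpose_mat R * ?D * R \<in> carrier_mat n n" using R D by auto
  have "transpose_mat (transpose_mat R * ?D * R) = transpose_mat R * (transpose_mat (transpose_mat R * ?D))"
    using R D by (subst transpose_mult[of _ n m _ n]) auto
  also have "transpose_mat (transpose_mat R * ?D) = ?D * R"
    using R D by (subst transpose_mult[of _ n m _ m]) (auto simp: transpose_diag_of_vec)
  also have "transpose_mat R * (?D * R) = transpose_mat R * ?D * R"
    using R D by (intro assoc_mult_mat[symmetric, of _ n m _ m _ n]) auto
  finally show ?thesis
    using transpose_minus[OF minus_carrier_mat[OF H(1)] G] transpose_minus[OF T H(1)] H(2)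
    by (simp add: transpose_diag_of_vec)
qed

text \<open>The block form at \<open>(x, y)\<close> is the squared length of
  \<open>x + B *\<^sub>v y\<close>. Thus \<open>transpose_mat B * B\<close> is an admissible choice
  of \<open>H\<close>, and by the next lemma no admissible \<open>H\<close> has a smaller quadratic
  form.\<close>

lemma psd_gram:
  fixes B :: "real mat"
  assumes B: "B \<in> carrier_mat m n"
  shows "psd_mat n (transpose_mat B * B)"
    and "psd_mat (m + n) (four_block_mat (1\<^sub>m m) B (transpose_mat B) (transpose_mat B * B))"
proof -
  have BT: "transpose_mat B \<in> carrier_mat n m" and BB: "transpose_mat B * B \<in> carrier_mat n n"
    using B by auto
  have tr: "transpose_mat (transpose_mat B * B) = transpose_mat B * B"
    using B by (subst transpose_mult[of _ n m _ n]) auto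
  have mv: "x \<bullet> (transpose_mat B *\<^sub>v y) = y \<bullet> (B *\<^sub>v x)"
    if "x \<in> carrier_vec n" "y \<in> carrier_vec m" for x y
    using transpose_vec_mult_scalar[OF B that] comm_scalar_prod[of x n "transpose_mat B *\<^sub>v y"] B that
    by auto
  have assoc: "transpose_mat B * B *\<^sub>v x = transpose_mat B *\<^sub>v (B *\<^sub>v x)" if "x \<in> carrier_vec n" for x
    using assoc_mult_mat_vec[OF BT B that] .
  show "psd_mat n (transpose_mat B * B)"
    unfolding psd_mat_def
    using BB tr B by (auto simp: assoc mv scalar_prod_self_nonneg)
  show "psd_mat (m + n) (four_block_mat (1\<^sub>m m) B (transpose_mat B) (transpose_mat B * B))" (is "psd_mat _ ?N")
    unfolding psd_mat_def
  proof (intro conjI ballI)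
    show "?N \<in> carrier_mat (m + n) (m + n)" using B by auto
    show "transpose_mat ?N = ?N"
      using B by (subst transpose_four_block_mat[of _ m m _ n _ n]) (auto simp: tr)
    fix z :: "real vec" assume "z \<in> carrier_vec (m + n)"
    then obtain x y where xy: "x \<in> carrier_vec m" "y \<in> carrier_vec n" "z = x @\<^sub>v y"
      by (rule split_vec)
    have By: "B *\<^sub>v y \<in> carrier_vec m" using B xy by auto
    have "?N *\<^sub>v z = (1\<^sub>m m *\<^sub>v x + B *\<^sub>v y) @\<^sub>v (transpose_mat B *\<^sub>v x + transpose_mat B * B *\<^sub>v y)"
      unfolding xy(3) using xy B by (intro four_block_mat_mult_vec[of _ m m _ n _ n]) auto
    then have "z \<bullet> (?N *\<^sub>v z) = x \<bullet> (x + B *\<^sub>v y) + y \<bullet> (transpose_mat B *\<^sub>v x + transpose_mat B * B *\<^sub>v y)"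
      unfolding xy(3) using xy B by (simp, subst scalar_prod_append[of _ m _ n]) auto
    also have "\<dots> = x \<bullet> x + x \<bullet> (B *\<^sub>v y) + (x \<bullet> (B *\<^sub>v y) + (B *\<^sub>v y) \<bullet> (B *\<^sub>v y))"
      using xy B By by (simp add: scalar_prod_add_distrib[of _ m] scalar_prod_add_distrib[of _ n] assoc mv)
    also have "\<dots> = (x + B *\<^sub>v y) \<bullet> (x + B *\<^sub>v y)"
      using xy By comm_scalar_prod[OF xy(1) By]
      by (simp add: scalar_prod_add_distrib[of _ m] add_scalar_prod_distrib[of _ m])
    finally show "0 \<le> z \<bullet> (?N *\<^sub>v z)" by (simp add: scalar_prod_self_nonneg)
  qed
qed

text \<open>One half of the Schur complement criterion, obtained from a single test vector.\<close>

lemma schur_lower_bound: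
  fixes B :: "real mat"
  assumes B: "B \<in> carrier_mat m n" and H: "H \<in> carrier_mat n n" and y: "y \<in> carrier_vec n"
    and psd: "psd_mat (m + n) (four_block_mat (1\<^sub>m m) B (transpose_mat B) H)"
  shows "(B *\<^sub>v y) \<bullet> (B *\<^sub>v y) \<le> y \<bullet> (H *\<^sub>v y)"
proof -
  let ?N = "four_block_mat (1\<^sub>m m) B (transpose_mat B) H" and ?b = "B *\<^sub>v y"
  \<comment> \<open>For fixed \<open>y\<close> this first block minimises the form, and it makes the
    upper part of \<open>?N *\<^sub>v ?z\<close> vanish.\<close>
  let ?z = "(- ?b) @\<^sub>v y"
  have b: "?b \<in> carrier_vec m" using B y by auto
  have "?N *\<^sub>v ?z = (1\<^sub>m m *\<^sub>v (- ?b) + ?b) @\<^sub>v (transpose_mat B *\<^sub>v (- ?b) + H *\<^sub>v y)"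
    using B H y b by (intro four_block_mat_mult_vec[of _ m m _ n _ n]) auto
  also have "1\<^sub>m m *\<^sub>v (- ?b) = - ?b" using b by simp
  finally have "?z \<bullet> (?N *\<^sub>v ?z) = ?z \<bullet> ((- ?b + ?b) @\<^sub>v (transpose_mat B *\<^sub>v (- ?b) + H *\<^sub>v y))"
    by (rule arg_cong)
  also have "\<dots> = (- ?b) \<bullet> (- ?b + ?b) + y \<bullet> (transpose_mat B *\<^sub>v (- ?b) + H *\<^sub>v y)"
    using B H y b by (intro scalar_prod_append[of _ m _ n]) auto
  also have "- ?b + ?b = 0\<^sub>v m" using b by auto
  also have "y \<bullet> (transpose_mat B *\<^sub>v (- ?b) + H *\<^sub>v y) = y \<bullet> (transpose_mat B *\<^sub>v (- ?b)) + y \<bullet> (H *\<^sub>v y)"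
    using B H y b by (intro scalar_prod_add_distrib[of _ n]) auto
  also have "y \<bullet> (transpose_mat B *\<^sub>v (- ?b)) = - (?b \<bullet> ?b)"
    using transpose_vec_mult_scalar[OF B y, of "- ?b"] comm_scalar_prod[of y n "transpose_mat B *\<^sub>v (- ?b)"] B y b
    by auto
  finally have "?z \<bullet> (?N *\<^sub>v ?z) = y \<bullet> (H *\<^sub>v y) - ?b \<bullet> ?b" using b by simp
  moreover have "0 \<le> ?z \<bullet> (?N *\<^sub>v ?z)"
    using psd b y unfolding psd_mat_def by (meson append_carrier_vec uminus_carrier_vec)
  ultimately show ?thesis by simp
qed

subsection \<open>Copositive certificates\<close>

lemma sum_append_zero:
  fixes f :: "nat \<Rightarrow> real"
  assumes "\<gamma> \<in> carrier_vec N"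
  shows "(\<Sum>i<N + k. (\<gamma> @\<^sub>v 0\<^sub>v k) $ i * f i) = (\<Sum>i<N. \<gamma> $ i * f i)"
proof -
  have "(\<Sum>i<N + k. (\<gamma> @\<^sub>v 0\<^sub>v k) $ i * f i) = (\<Sum>i<N. (\<gamma> @\<^sub>v 0\<^sub>v k) $ i * f i)"
    using assms by (intro sum.mono_neutral_right) auto
  also have "\<dots> = (\<Sum>i<N. \<gamma> $ i * f i)"
    using assms by (intro sum.cong) auto
  finally show ?thesis .
qed

lemma scalar_prod_eq_sum:
  "z \<in> carrier_vec n \<Longrightarrow> u \<bullet> z = (\<Sum>i<n. u $ i * z $ i)"
  by (auto simp: scalar_prod_def atLeast0LessThan)

lemma hadamard_scalar_prod:
  "t \<in> carrier_vec m \<Longrightarrow> \<phi> \<in> carrier_vec m \<Longrightarrow>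
    hadamard_vec t t \<bullet> \<phi> = (\<Sum>j<m. \<phi> $ j * (t $ j)\<^sup>2)"
  by (auto simp: scalar_prod_eq_sum hadamard_vec_def power2_eq_square mult_ac intro!: sum.cong)

text \<open>Copositivity is evaluated at \<open>(z, 1)\<close>. For entries with
  \<open>(z $ i)\<^sup>2 = z $ i\<close> the diagonal and the linear share of
  \<open>\<gamma>\<close> cancel, and \<open>schur_lower_bound\<close> replaces the form of
  \<open>H\<close> by that of \<open>B\<close>. With \<open>R *\<^sub>v z\<close> kept on the right,
  the objective appears as soon as this vector equals the lifted right-hand side.\<close>

lemma copositive_certificate_bound:
  fixes R B H :: "real mat"
  assumes R: "R \<in> carrier_mat m (N + k)" and B: "B \<in> carrier_mat M (N + k)"
    and b: "b \<in> carrier_vec (N + k)" and \<psi>: "\<psi> \<in> carrier_vec m" and \<phi>: "\<phi> \<in> carrier_vec m"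
    and \<gamma>: "\<gamma> \<in> carrier_vec N" and H: "H \<in> carrier_mat (N + k) (N + k)"
    and psd: "psd_mat (M + (N + k)) (four_block_mat (1\<^sub>m M) B (transpose_mat B) H)"
    and cop: "copositive_mat ((N + k) + 1)
      (four_block_mat
        (transpose_mat R * diag_of_vec \<phi> * R - H - diag_of_vec (\<gamma> @\<^sub>v 0\<^sub>v k))
        (transpose_mat (mat_of_row ((1/2) \<cdot>\<^sub>v (transpose_mat R *\<^sub>v \<psi> - b + (\<gamma> @\<^sub>v 0\<^sub>v k)))))
        (mat_of_row ((1/2) \<cdot>\<^sub>v (transpose_mat R *\<^sub>v \<psi> - b + (\<gamma> @\<^sub>v 0\<^sub>v k))))
        (Matrix.mat 1 1 (\<lambda>_. \<tau>)))"
    and z: "z \<in> carrier_vec (N + k)" and z0: "\<forall>i<N + k. 0 \<le> z $ i"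
    and bin: "\<forall>i<N. (z $ i)\<^sup>2 = z $ i"
  shows "(B *\<^sub>v z) \<bullet> (B *\<^sub>v z) + b \<bullet> z
    \<le> (R *\<^sub>v z) \<bullet> \<psi> + hadamard_vec (R *\<^sub>v z) (R *\<^sub>v z) \<bullet> \<phi> + \<tau>"
proof -
  let ?g = "\<gamma> @\<^sub>v 0\<^sub>v k" and ?n = "N + k"
  let ?P = "transpose_mat R * diag_of_vec \<phi> * R - H - diag_of_vec ?g"
  let ?u = "(1/2) \<cdot>\<^sub>v (transpose_mat R *\<^sub>v \<psi> - b + ?g)"
  have g: "?g \<in> carrier_vec ?n" using \<gamma> by (intro append_carrier_vec) auto
  have Rz: "R *\<^sub>v z \<in> carrier_vec m" using R z by auto
  have P: "?P \<in> carrier_mat ?n ?n" using g by (intro minus_carrier_mat diag_of_vec_carrier)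
  have u: "?u \<in> carrier_vec ?n" using g R b \<psi> by auto
  have "0 \<le> z \<bullet> (?P *\<^sub>v z) + 2 * 1 * (?u \<bullet> z) + \<tau> * 1\<^sup>2"
    using z0 by (intro copositive_blockD[OF cop P u z]) auto
  also have "z \<bullet> (?P *\<^sub>v z) = hadamard_vec (R *\<^sub>v z) (R *\<^sub>v z) \<bullet> \<phi> - z \<bullet> (H *\<^sub>v z) - (\<Sum>i<N. \<gamma> $ i * z $ i)"
    unfolding quadratic_part_form[OF R H \<phi> g z] sum_append_zero[OF \<gamma>] hadamard_scalar_prod[OF Rz \<phi>]
    using bin by simp
  also have "?u \<bullet> z = (\<psi> \<bullet> (R *\<^sub>v z) - b \<bullet> z + (\<Sum>i<N. \<gamma> $ i * z $ i)) / 2"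
    unfolding linear_part_form[OF R \<psi> b g z]
    by (simp add: scalar_prod_eq_sum[OF z, of ?g] sum_append_zero[OF \<gamma>])
  finally show ?thesis
    using schur_lower_bound[OF B H z psd] comm_scalar_prod[OF \<psi> Rz] by (simp add: field_simps)
qed

text \<open>Collects the three contributions of \<open>\<rho>\<close>, through
  \<open>\<phi>\<close>, \<open>\<psi>\<close> and the corner entry, into one squared
  residual.\<close>

lemma residual_power2_sum:
  fixes x t :: "real vec"
  assumes "x \<in> carrier_vec m" "t \<in> carrier_vec m"
  shows "(\<Sum>j<m. (x $ j - s * t $ j)\<^sup>2) = (\<Sum>j<m. (x $ j)\<^sup>2) - 2 * s * (t \<bullet> x) + s\<^sup>2 * (t \<bullet> t)"
  unfolding scalar_prod_eq_sum[OF assms(1)] scalar_prod_eq_sum[OF assms(2)]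
  by (simp add: power2_eq_square algebra_simps sum.distrib sum_subtractf sum_distrib_left)

text \<open>The hypothesis \<open>nonneg\<close> controls the sign of the digit penalty only where
  the residual \<open>R z - s t\<close> vanishes, so \<open>\<mu>\<close> is fixed there first. Then
  \<open>\<rho>\<close> takes care of the rest of the simplex, where the digit penalty may be
  negative.\<close>

lemma copositive_certificate_exists:
  fixes R B :: "real mat" and v :: real
  assumes R: "R \<in> carrier_mat m (N + k)" and B: "B \<in> carrier_mat M (N + k)"
    and t: "t \<in> carrier_vec m" and b: "b \<in> carrier_vec (N + k)"
    and nonneg: "\<And>z s. z \<in> carrier_vec (N + k) \<Longrightarrow> \<forall>i<N + k. 0 \<le> z $ i \<Longrightarrow> 0 \<le> s \<Longrightarrow>
      R *\<^sub>v z = s \<cdot>\<^sub>v t \<Longrightarrow> 0 \<le> (\<Sum>i<N. s * z $ i - (z $ i)\<^sup>2)"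
    and pos: "\<And>z s. z \<in> carrier_vec (N + k) \<Longrightarrow> \<forall>i<N + k. 0 \<le> z $ i \<Longrightarrow> 0 \<le> s \<Longrightarrow>
      R *\<^sub>v z = s \<cdot>\<^sub>v t \<Longrightarrow> (\<Sum>i<N + k. z $ i) + s = 1 \<Longrightarrow> (\<Sum>i<N. s * z $ i - (z $ i)\<^sup>2) = 0 \<Longrightarrow>
      (B *\<^sub>v z) \<bullet> (B *\<^sub>v z) + s * (b \<bullet> z) < v * s\<^sup>2"
  shows "\<exists>\<rho> \<mu>. copositive_mat ((N + k) + 1)
      (four_block_mat
        (transpose_mat R * diag_of_vec (\<rho> \<cdot>\<^sub>v ones_vec m) * R - transpose_mat B * B
          - diag_of_vec ((\<mu> \<cdot>\<^sub>v ones_vec N) @\<^sub>v 0\<^sub>v k))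
        (transpose_mat (mat_of_row ((1/2) \<cdot>\<^sub>v
          (transpose_mat R *\<^sub>v ((- 2 * \<rho>) \<cdot>\<^sub>v t) - b + ((\<mu> \<cdot>\<^sub>v ones_vec N) @\<^sub>v 0\<^sub>v k)))))
        (mat_of_row ((1/2) \<cdot>\<^sub>v
          (transpose_mat R *\<^sub>v ((- 2 * \<rho>) \<cdot>\<^sub>v t) - b + ((\<mu> \<cdot>\<^sub>v ones_vec N) @\<^sub>v 0\<^sub>v k))))
        (Matrix.mat 1 1 (\<lambda>_. v + \<rho> * (t \<bullet> t))))"
proof -
  let ?n = "N + k"
  define C where "C = std_simplex (?n + 1)"
  define z where "z w = Matrix.vec ?n w" for w :: "nat \<Rightarrow> real"
  \<comment> \<open>The coordinate \<open>w ?n\<close> is the homogenising scalar \<open>s\<close>.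
    Here \<open>r\<close> is the squared residual, \<open>p\<close> the digit penalty and
    \<open>h\<close> the form without penalties.\<close>
  define r where "r w = (\<Sum>j<m. ((R *\<^sub>v z w) $ j - w ?n * t $ j)\<^sup>2)" for w
  define p where "p w = (\<Sum>i<N. w ?n * w i - (w i)\<^sup>2)" for w :: "nat \<Rightarrow> real"
  define h where "h w = v * (w ?n)\<^sup>2 - (B *\<^sub>v z w) \<bullet> (B *\<^sub>v z w) - w ?n * (b \<bullet> z w)" for w
  have z: "z w \<in> carrier_vec ?n" for w unfolding z_def by simp
  have zi: "z w $ i = w i" if "i < ?n" for w i using that unfolding z_def by simp
  have Rz: "R *\<^sub>v z w \<in> carrier_vec m" and Bz: "B *\<^sub>v z w \<in> carrier_vec M" for w
    using R B z by auto
  have cont_r: "continuous_on UNIV r"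
    unfolding r_def z_def
    by (intro continuous_intros continuous_on_mult_mat_vec_index[OF R] continuous_on_product_coordinates) auto
  have cont_p: "continuous_on UNIV p"
    unfolding p_def by (intro continuous_intros continuous_on_product_coordinates)
  have cont_h: "continuous_on UNIV h"
    unfolding h_def scalar_prod_eq_sum[OF Bz] unfolding z_def
    by (intro continuous_intros continuous_on_mult_mat_vec_index[OF B] continuous_on_scalar_prod_vec[OF b]
        continuous_on_product_coordinates) auto
  have r0: "0 \<le> r w" for w unfolding r_def by (intro sum_nonneg) auto
  have r_eq: "R *\<^sub>v z w = w ?n \<cdot>\<^sub>v t" if "r w = 0" for w
  proof (rule eq_vecI)
    have "\<forall>j<m. (R *\<^sub>v z w) $ j - w ?n * t $ j = 0"
      using that unfolding r_def by (subst (asm) sum_nonneg_eq_0_iff) auto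
    then show "(R *\<^sub>v z w) $ j = (w ?n \<cdot>\<^sub>v t) $ j" if "j < dim_vec (w ?n \<cdot>\<^sub>v t)" for j
      using that t by auto
  qed (use R t in auto)
  have w0: "0 \<le> w i" if "w \<in> C" for w i using that unfolding C_def std_simplex_def by blast
  have w1: "(\<Sum>i<?n. z w $ i) + w ?n = 1" if "w \<in> C" for w
    using that unfolding C_def std_simplex_def by (simp add: zi)
  have zp: "(\<Sum>i<N. w ?n * z w $ i - (z w $ i)\<^sup>2) = p w" for w
    unfolding p_def by (intro sum.cong) (auto simp: zi)
  have C: "compact C" unfolding C_def by (rule compact_std_simplex)
  have C0: "compact (C \<inter> {w. r w = 0})"
    using C by (intro compact_Int_closed closed_Collect_eq cont_r continuous_on_const)
  have "\<exists>\<mu>\<ge>0. \<forall>w\<in>C \<inter> {w. r w = 0}. 0 < h w + \<mu> * p w"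
  proof (rule penalty_on_compact[OF C0])
    show "continuous_on (C \<inter> {w. r w = 0}) h" "continuous_on (C \<inter> {w. r w = 0}) p"
      using cont_h cont_p continuous_on_subset by blast+
    fix w assume w: "w \<in> C \<inter> {w. r w = 0}"
    show "0 \<le> p w"
      using nonneg[OF z, of w "w ?n"] w w0 r_eq by (simp add: zi p_def)
    show "0 < h w" if "p w = 0"
      using pos[OF z, of w "w ?n"] w w0 w1 r_eq that by (simp add: zi p_def h_def)
  qed
  then obtain \<mu> where \<mu>: "\<forall>w\<in>C \<inter> {w. r w = 0}. 0 < h w + \<mu> * p w" by blast
  \<comment> \<open>Now \<open>h + \<mu> * p\<close> has to be positive only where \<open>r\<close>
    vanishes, which is how \<open>\<mu>\<close> was chosen; \<open>r\<close> itself is nonnegative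
    everywhere.\<close>
  have "\<exists>\<rho>\<ge>0. \<forall>w\<in>C. 0 < h w + \<mu> * p w + \<rho> * r w"
  proof (rule penalty_on_compact[OF C])
    have "continuous_on UNIV (\<lambda>w. h w + \<mu> * p w)"
      by (intro continuous_intros cont_h cont_p)
    then show "continuous_on C (\<lambda>w. h w + \<mu> * p w)" "continuous_on C r"
      using cont_r continuous_on_subset by blast+
  qed (use r0 \<mu> in auto)
  then obtain \<rho> where \<rho>: "\<forall>w\<in>C. 0 < h w + \<mu> * p w + \<rho> * r w" by blast
  let ?g = "(\<mu> \<cdot>\<^sub>v ones_vec N) @\<^sub>v 0\<^sub>v k" and ?\<phi> = "\<rho> \<cdot>\<^sub>v ones_vec m" and ?\<psi> = "(- 2 * \<rho>) \<cdot>\<^sub>v t"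
  let ?H = "transpose_mat B * B"
  let ?P = "transpose_mat R * diag_of_vec ?\<phi> * R - ?H - diag_of_vec ?g"
  let ?u = "(1/2) \<cdot>\<^sub>v (transpose_mat R *\<^sub>v ?\<psi> - b + ?g)"
  have \<gamma>: "\<mu> \<cdot>\<^sub>v ones_vec N \<in> carrier_vec N" and \<phi>: "?\<phi> \<in> carrier_vec m" and \<psi>: "?\<psi> \<in> carrier_vec m"
    using t by (auto simp: ones_vec_def)
  have g: "?g \<in> carrier_vec ?n" using \<gamma> by (intro append_carrier_vec) auto
  have psd: "psd_mat ?n ?H" using psd_gram(1)[OF B] .
  then have H: "?H \<in> carrier_mat ?n ?n" "transpose_mat ?H = ?H" unfolding psd_mat_def by blast+
  have "copositive_mat (?n + 1)
      (four_block_mat ?P (transpose_mat (mat_of_row ?u)) (mat_of_row ?u) (Matrix.mat 1 1 (\<lambda>_. v + \<rho> * (t \<bullet> t))))"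
  proof (rule copositive_blockI)
    show "?P \<in> carrier_mat ?n ?n" using g by (intro minus_carrier_mat diag_of_vec_carrier)
    show "?u \<in> carrier_vec ?n" using g R b \<psi> by auto
    show "transpose_mat ?P = ?P" by (rule transpose_quadratic_part[OF R H \<phi> g])
    fix w assume "w \<in> std_simplex (?n + 1)"
    then have pos: "0 < h w + \<mu> * p w + \<rho> * r w" using \<rho> C_def by blast
    have "z w \<bullet> (?H *\<^sub>v z w) = (B *\<^sub>v z w) \<bullet> (B *\<^sub>v z w)"
      using transpose_vec_mult_scalar[OF B z Bz, of w w] B z[of w]
        comm_scalar_prod[OF z, of "transpose_mat B *\<^sub>v (B *\<^sub>v z w)" w]
      by (simp add: assoc_mult_mat_vec[of _ ?n M _ ?n])
    then have q: "z w \<bullet> (?P *\<^sub>v z w) = \<rho> * (\<Sum>j<m. ((R *\<^sub>v z w) $ j)\<^sup>2) - (B *\<^sub>v z w) \<bullet> (B *\<^sub>v z w) - \<mu> * (\<Sum>i<N. (w i)\<^sup>2)"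
      unfolding quadratic_part_form[OF R H(1) \<phi> g z] sum_append_zero[OF \<gamma>]
      by (simp add: ones_vec_def sum_distrib_left zi)
    have l: "2 * (?u \<bullet> z w) = - 2 * \<rho> * (t \<bullet> (R *\<^sub>v z w)) - b \<bullet> z w + \<mu> * (\<Sum>i<N. w i)"
      unfolding linear_part_form[OF R \<psi> b g z] scalar_prod_eq_sum[OF z, of ?g] sum_append_zero[OF \<gamma>]
        smult_scalar_prod_distrib[OF t Rz]
      by (simp add: ones_vec_def zi flip: sum_distrib_left)
    have p: "p w = w ?n * (\<Sum>i<N. w i) - (\<Sum>i<N. (w i)\<^sup>2)"
      unfolding p_def by (simp add: sum_subtractf sum_distrib_left)
    \<comment> \<open>The terms in \<open>\<rho>\<close> assemble to \<open>\<rho> * r w\<close> and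
      those in \<open>\<mu>\<close> to \<open>\<mu> * p w\<close>, so the form is the penalised
      function already known to be positive.\<close>
    have "z w \<bullet> (?P *\<^sub>v z w) + w ?n * (2 * (?u \<bullet> z w)) + (v + \<rho> * (t \<bullet> t)) * (w ?n)\<^sup>2
        = h w + \<mu> * p w + \<rho> * r w"
      unfolding q l p h_def r_def residual_power2_sum[OF Rz t] by (simp add: algebra_simps)
    then show "0 \<le> Matrix.vec ?n w \<bullet> (?P *\<^sub>v Matrix.vec ?n w) + 2 * w ?n * (?u \<bullet> Matrix.vec ?n w)
        + (v + \<rho> * (t \<bullet> t)) * (w ?n)\<^sup>2"
      using pos unfolding z_def by (simp add: mult_ac)
  qed
  then show ?thesis by blast
qed

subsection \<open>The lifted system\<close>

lemma div_mod_less_mult: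
  fixes l q :: nat
  assumes "l < L" "q < Q"
  shows "l * Q + q < L * Q" "(l * Q + q) div Q = l" "(l * Q + q) mod Q = q"
proof -
  have "l * Q + q < Suc l * Q" using assms by simp
  also have "\<dots> \<le> L * Q" using assms by (intro mult_le_mono1) simp
  finally show "l * Q + q < L * Q" .
qed (use assms in auto)

text \<open>A vector of length \<open>L * Q\<close> is cut into \<open>L\<close> blocks of length
  \<open>Q\<close>; the identity factor keeps block \<open>l\<close> only, on which \<open>w\<close>
  acts as a row.\<close>

lemma kronecker_one_row_mult:
  assumes "w \<in> carrier_vec Q" "\<beta> \<in> carrier_vec (L * Q)"
  shows "kronecker (1\<^sub>m L) (mat_of_row w) *\<^sub>v \<beta> = Matrix.vec L (\<lambda>l. \<Sum>q<Q. w $ q * \<beta> $ (l * Q + q))"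
proof (rule eq_vecI)
  fix l assume "l < dim_vec (Matrix.vec L (\<lambda>l. \<Sum>q<Q. w $ q * \<beta> $ (l * Q + q)))"
  then have l: "l < L" by simp
  let ?f = "\<lambda>j. (1\<^sub>m L :: real mat) $$ (l, j div Q) * w $ (j mod Q) * \<beta> $ j"
  have dims: "dim_vec w = Q" "dim_vec \<beta> = L * Q" using assms by auto
  have "(kronecker (1\<^sub>m L) (mat_of_row w) *\<^sub>v \<beta>) $ l = sum ?f {..<L * Q}"
    using l dims by (auto simp: kronecker_def scalar_prod_def atLeast0LessThan less_mult_imp_div_less intro!: sum.cong)
      (metis dims(1) mat_of_row_index mod_less_divisor mult_0_right not_less_zero zero_less_iff_neq_zero)
  also have "\<dots> = (\<Sum>m<L. sum ?f {m * Q..<m * Q + Q})"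
    by (rule sum.nat_group[symmetric])
  also have "\<dots> = (\<Sum>m<L. if l = m then \<Sum>q<Q. w $ q * \<beta> $ (l * Q + q) else 0)"
  proof (rule sum.cong)
    fix m assume m: "m \<in> {..<L}"
    have "sum ?f {m * Q..<m * Q + Q} = (\<Sum>q<Q. ?f (m * Q + q))"
      using sum.shift_bounds_nat_ivl[of ?f 0 "m * Q" Q] by (simp add: add.commute atLeast0LessThan)
    also have "\<dots> = (\<Sum>q<Q. if l = m then w $ q * \<beta> $ (l * Q + q) else 0)"
      using m l by (intro sum.cong) auto
    finally show "sum ?f {m * Q..<m * Q + Q} = (if l = m then \<Sum>q<Q. w $ q * \<beta> $ (l * Q + q) else 0)"
      by simp
  qed simp
  also have "\<dots> = (\<Sum>q<Q. w $ q * \<beta> $ (l * Q + q))" using l by simp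
  finally show "(kronecker (1\<^sub>m L) (mat_of_row w) *\<^sub>v \<beta>) $ l
      = Matrix.vec L (\<lambda>l. \<Sum>q<Q. w $ q * \<beta> $ (l * Q + q)) $ l"
    using l by simp
qed (simp add: kronecker_def)

lemma kronecker_carrier:
  "w \<in> carrier_vec Q \<Longrightarrow> kronecker (1\<^sub>m L) (mat_of_row w) \<in> carrier_mat L (L * Q)"
  by (intro carrier_matI) (auto simp: kronecker_def)

lemma pow2_vec_carrier: "pow2_vec Q \<in> carrier_vec Q"
  by (simp add: pow2_vec_def)

text \<open>The column count is written \<open>L * Q + (L * Q + K)\<close> to match the nested
  splitting of a lifted vector into \<open>\<beta>\<close>, \<open>\<eta>\<close> and
  \<open>\<xi>\<close>.\<close>

lemma lift_S_carrier:
  assumes S: "S \<in> carrier_mat J K" and LK: "L \<le> K"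
  shows "lift_S J K L Q S \<in> carrier_mat (L * Q + J + L) (L * Q + (L * Q + K))"
proof -
  have "lift_S J K L Q S \<in> carrier_mat (J + (L + L * Q)) (L * Q + (L * Q + (L + (K - L))))"
    unfolding lift_S_def using S LK kronecker_carrier[OF pow2_vec_carrier]
    by (intro carrier_append_rows append_cols_carrier uminus_carrier_mat) auto
  then show ?thesis using LK by (simp add: ac_simps)
qed

lemma lift_S_mult:
  assumes S: "S \<in> carrier_mat J K" and LK: "L \<le> K"
    and \<beta>: "\<beta> \<in> carrier_vec (L * Q)" and \<eta>: "\<eta> \<in> carrier_vec (L * Q)" and \<xi>: "\<xi> \<in> carrier_vec K"
  shows "lift_S J K L Q S *\<^sub>v (\<beta> @\<^sub>v \<eta> @\<^sub>v \<xi>) =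
    (S *\<^sub>v \<xi>) @\<^sub>v Matrix.vec L (\<lambda>l. \<xi> $ l - (\<Sum>q<Q. 2 ^ q * \<beta> $ (l * Q + q))) @\<^sub>v (\<beta> + \<eta>)"
proof -
  let ?z = "\<beta> @\<^sub>v \<eta> @\<^sub>v \<xi>" and ?Kr = "kronecker (1\<^sub>m L) (mat_of_row (pow2_vec Q))"
  let ?E = "1\<^sub>m L @\<^sub>c 0\<^sub>m L (K - L) :: real mat"
  have Kr: "?Kr \<in> carrier_mat L (L * Q)" by (rule kronecker_carrier[OF pow2_vec_carrier])
  have E: "?E \<in> carrier_mat L K"
    using append_cols_carrier[of "1\<^sub>m L" L L "0\<^sub>m L (K - L) :: real mat" "K - L"] LK by simp
  have z: "?z \<in> carrier_vec (L * Q + (L * Q + K))" using \<beta> \<eta> \<xi> by (intro append_carrier_vec)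
  have cols: "(X @\<^sub>c Y @\<^sub>c Z) *\<^sub>v ?z = X *\<^sub>v \<beta> + (Y *\<^sub>v \<eta> + Z *\<^sub>v \<xi>)"
    if "X \<in> carrier_mat m (L * Q)" "Y \<in> carrier_mat m (L * Q)" "Z \<in> carrier_mat m K" for m X Y Z
    using that \<beta> \<eta> \<xi>
    by (simp add: append_cols_mult_vec[of _ m "L * Q" _ "L * Q + K"] append_cols_mult_vec[of _ m "L * Q" _ K])
  \<comment> \<open>Since \<open>L \<le> K\<close>, the vector splits after its first
    \<open>L\<close> entries, and the block picks exactly the integer coordinates.\<close>
  have E\<xi>: "?E *\<^sub>v \<xi> = Matrix.vec L (\<lambda>l. \<xi> $ l)"
  proof -
    have "\<xi> \<in> carrier_vec (L + (K - L))" using \<xi> LK by simp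
    then obtain x y where xy: "x \<in> carrier_vec L" "y \<in> carrier_vec (K - L)" "\<xi> = x @\<^sub>v y"
      by (rule split_vec)
    then have "?E *\<^sub>v \<xi> = x"
      by (simp add: append_cols_mult_vec[of _ L L _ "K - L"])
    also have "x = Matrix.vec L (\<lambda>l. \<xi> $ l)" using xy by (intro eq_vecI) auto
    finally show ?thesis .
  qed
  have "lift_S J K L Q S *\<^sub>v ?z =
      ((0\<^sub>m J (L*Q) @\<^sub>c 0\<^sub>m J (L*Q) @\<^sub>c S) *\<^sub>v ?z) @\<^sub>v
      ((- ?Kr @\<^sub>c 0\<^sub>m L (L*Q) @\<^sub>c ?E) *\<^sub>v ?z) @\<^sub>v
      ((1\<^sub>m (L*Q) @\<^sub>c 1\<^sub>m (L*Q) @\<^sub>c 0\<^sub>m (L*Q) K) *\<^sub>v ?z)"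
    unfolding lift_S_def using S Kr E z
    by (subst mat_mult_append[of _ J "L * Q + (L * Q + K)" _ "L + L * Q"],
        auto intro!: carrier_append_rows append_cols_carrier)
      (subst mat_mult_append[of _ L "L * Q + (L * Q + K)" _ "L * Q"],
        auto intro!: append_cols_carrier)
  also have "(0\<^sub>m J (L*Q) @\<^sub>c 0\<^sub>m J (L*Q) @\<^sub>c S) *\<^sub>v ?z = S *\<^sub>v \<xi>"
    using S \<beta> \<eta> \<xi> by (subst cols[of _ J]) auto
  also have "(1\<^sub>m (L*Q) @\<^sub>c 1\<^sub>m (L*Q) @\<^sub>c 0\<^sub>m (L*Q) K) *\<^sub>v ?z = \<beta> + \<eta>"
    using \<beta> \<eta> \<xi> by (subst cols[of _ "L * Q"]) auto
  also have "(- ?Kr @\<^sub>c 0\<^sub>m L (L*Q) @\<^sub>c ?E) *\<^sub>v ?z = - ?Kr *\<^sub>v \<beta> + (0\<^sub>v L + Matrix.vec L (\<lambda>l. \<xi> $ l))"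
    using Kr E \<beta> \<eta> \<xi> E\<xi> by (subst cols[of _ L]) auto
  also have "- ?Kr *\<^sub>v \<beta> = - (?Kr *\<^sub>v \<beta>)"
    using Kr \<beta> by (intro uminus_mult_mat_vec) auto
  also have "- (?Kr *\<^sub>v \<beta>) + (0\<^sub>v L + Matrix.vec L (\<lambda>l. \<xi> $ l))
      = Matrix.vec L (\<lambda>l. \<xi> $ l - (\<Sum>q<Q. 2 ^ q * \<beta> $ (l * Q + q)))"
    unfolding kronecker_one_row_mult[OF pow2_vec_carrier \<beta>]
    by (intro eq_vecI) (auto simp: pow2_vec_def)
  finally show ?thesis .
qed

text \<open>The right-hand side is scaled by \<open>s\<close> to serve two uses:
  \<open>s = 1\<close> for lifts of points of the uncertainty set, and any \<open>s\<close>,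
  including 0, for the cone on which the certificate is tested.\<close>

lemma lift_S_eq_iff:
  assumes S: "S \<in> carrier_mat J K" and t: "t \<in> carrier_vec J" and LK: "L \<le> K"
    and \<beta>: "\<beta> \<in> carrier_vec (L * Q)" and \<eta>: "\<eta> \<in> carrier_vec (L * Q)" and \<xi>: "\<xi> \<in> carrier_vec K"
  shows "lift_S J K L Q S *\<^sub>v (\<beta> @\<^sub>v \<eta> @\<^sub>v \<xi>) = s \<cdot>\<^sub>v lift_t L Q t \<longleftrightarrow>
    S *\<^sub>v \<xi> = s \<cdot>\<^sub>v t \<and> (\<forall>l<L. \<xi> $ l = (\<Sum>q<Q. 2 ^ q * \<beta> $ (l * Q + q))) \<and>
    (\<forall>i<L * Q. \<beta> $ i + \<eta> $ i = s)"
proof -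
  have st: "s \<cdot>\<^sub>v lift_t L Q t = (s \<cdot>\<^sub>v t) @\<^sub>v 0\<^sub>v L @\<^sub>v (s \<cdot>\<^sub>v ones_vec (L * Q))"
    unfolding lift_t_def using t by (intro eq_vecI) (auto simp: ones_vec_def)
  have S\<xi>: "S *\<^sub>v \<xi> \<in> carrier_vec J" "s \<cdot>\<^sub>v t \<in> carrier_vec J" using S \<xi> t by auto
  have 1: "Matrix.vec L f = 0\<^sub>v L \<longleftrightarrow> (\<forall>l<L. f l = 0)" for f :: "nat \<Rightarrow> real"
    by (auto simp: vec_eq_iff)
  have 2: "\<beta> + \<eta> = s \<cdot>\<^sub>v ones_vec (L * Q) \<longleftrightarrow> (\<forall>i<L * Q. \<beta> $ i + \<eta> $ i = s)"
    using \<beta> \<eta> by (auto simp: vec_eq_iff ones_vec_def)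
  show ?thesis
    unfolding lift_S_mult[OF S LK \<beta> \<eta> \<xi>] st append_vec_eq[OF S\<xi>]
      append_vec_eq[OF vec_carrier zero_carrier_vec] 1 2 by simp
qed

lemma lift_t_carrier: "t \<in> carrier_vec J \<Longrightarrow> lift_t L Q t \<in> carrier_vec (L * Q + J + L)"
  by (rule carrier_vecI) (auto simp: lift_t_def ones_vec_def)

lemma lift_A_carrier: "A \<in> carrier_mat M K \<Longrightarrow> lift_A M L Q A \<in> carrier_mat M (L * Q + (L * Q + K))"
  unfolding lift_A_def by (intro append_cols_carrier) auto

lemma lift_b_carrier: "b \<in> carrier_vec K \<Longrightarrow> lift_b L Q b \<in> carrier_vec (L * Q + (L * Q + K))"
  unfolding lift_b_def by (intro append_carrier_vec) auto

lemma lift_A_mult: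
  assumes "A \<in> carrier_mat M K" "\<beta> \<in> carrier_vec (L * Q)" "\<eta> \<in> carrier_vec (L * Q)" "\<xi> \<in> carrier_vec K"
  shows "lift_A M L Q A *\<^sub>v (\<beta> @\<^sub>v \<eta> @\<^sub>v \<xi>) = A *\<^sub>v \<xi>"
  unfolding lift_A_def using assms
  by (simp add: append_cols_mult_vec[of _ M "L * Q" _ "L * Q + K"] append_cols_mult_vec[of _ M "L * Q" _ K])

lemma lift_b_scalar_prod:
  assumes "b \<in> carrier_vec K" "\<beta> \<in> carrier_vec (L * Q)" "\<eta> \<in> carrier_vec (L * Q)" "\<xi> \<in> carrier_vec K"
  shows "lift_b L Q b \<bullet> (\<beta> @\<^sub>v \<eta> @\<^sub>v \<xi>) = b \<bullet> \<xi>"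
  unfolding lift_b_def using assms
  by (simp add: scalar_prod_append[of _ "L * Q" _ "L * Q + K"] scalar_prod_append[of _ "L * Q" _ K])

text \<open>The digits are the bits of the natural number; below \<open>2 ^ Q\<close> the first
  \<open>Q\<close> of them recover it.\<close>

lemma binary_digits:
  assumes "x \<in> real ` {0..2 ^ Q - 1}"
  shows "\<exists>d. (\<forall>q. d q = 0 \<or> d q = 1) \<and> x = (\<Sum>q<Q. 2 ^ q * d q)"
proof -
  obtain n :: nat where n: "n \<le> 2 ^ Q - 1" "x = real n" using assms by auto
  \<comment> \<open>The upper bound is a subtraction of natural numbers; it turns into a strict
    bound because \<open>2 ^ Q\<close> is positive.\<close>
  then have "n < 2 ^ Q" using zero_less_power[of "2::nat" Q] by linarith
  then have "n = (\<Sum>q = 0..<Q. push_bit q (of_bool (bit n q)))"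
    using take_bit_sum[of Q n] by (simp add: take_bit_nat_eq_self)
  then have "real n = real (\<Sum>q = 0..<Q. push_bit q (of_bool (bit n q)))" by simp
  also have "\<dots> = (\<Sum>q<Q. 2 ^ q * of_bool (bit n q))"
    unfolding of_nat_sum by (intro sum.cong) (auto simp: push_bit_eq_mult)
  finally show ?thesis
    using n by (intro exI[of _ "\<lambda>q. of_bool (bit n q)"]) auto
qed

text \<open>The vector \<open>\<beta>\<close> holds the bits of the integer coordinates, bit
  \<open>q\<close> of coordinate \<open>l\<close> at position \<open>l * Q + q\<close>, and
  \<open>\<eta>\<close> is its complement to the all-ones vector.\<close>

lemma binary_lift_exists:
  assumes S: "S \<in> carrier_mat J K" and t: "t \<in> carrier_vec J" and LK: "L \<le> K"
    and \<xi>: "\<xi> \<in> uncertainty_set K L S t" and Q: "\<forall>l<L. \<xi> $ l \<in> real ` {0..2 ^ Q - 1}"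
  shows "\<exists>\<beta> \<eta>. \<beta> \<in> carrier_vec (L * Q) \<and> \<eta> \<in> carrier_vec (L * Q) \<and>
    lift_S J K L Q S *\<^sub>v (\<beta> @\<^sub>v \<eta> @\<^sub>v \<xi>) = lift_t L Q t \<and>
    (\<forall>i<L * Q. (\<beta> $ i)\<^sup>2 = \<beta> $ i \<and> 0 \<le> \<beta> $ i \<and> 0 \<le> \<eta> $ i)"
proof -
  have \<xi>K: "\<xi> \<in> carrier_vec K" and S\<xi>: "S *\<^sub>v \<xi> = t"
    using \<xi> unfolding uncertainty_set_def by auto
  have "\<forall>l<L. \<exists>d. (\<forall>q. d q = 0 \<or> d q = 1) \<and> \<xi> $ l = (\<Sum>q<Q. 2 ^ q * d q)"
    using Q binary_digits by blast
  then obtain d :: "nat \<Rightarrow> nat \<Rightarrow> real" where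
    d: "\<And>l q. l < L \<Longrightarrow> d l q = 0 \<or> d l q = 1" "\<And>l. l < L \<Longrightarrow> \<xi> $ l = (\<Sum>q<Q. 2 ^ q * d l q)"
    by metis
  define \<beta> where "\<beta> = Matrix.vec (L * Q) (\<lambda>i. d (i div Q) (i mod Q))"
  define \<eta> where "\<eta> = Matrix.vec (L * Q) (\<lambda>i. 1 - \<beta> $ i)"
  have \<beta>i: "\<beta> $ i = 0 \<or> \<beta> $ i = 1" if "i < L * Q" for i
    using that d(1)[of "i div Q" "i mod Q"] by (simp add: \<beta>_def less_mult_imp_div_less)
  have c: "\<beta> \<in> carrier_vec (L * Q)" "\<eta> \<in> carrier_vec (L * Q)" by (auto simp: \<beta>_def \<eta>_def)
  have "\<xi> $ l = (\<Sum>q<Q. 2 ^ q * \<beta> $ (l * Q + q))" if "l < L" for l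
    unfolding d(2)[OF that] using that by (intro sum.cong) (auto simp: \<beta>_def div_mod_less_mult)
  then have "lift_S J K L Q S *\<^sub>v (\<beta> @\<^sub>v \<eta> @\<^sub>v \<xi>) = 1 \<cdot>\<^sub>v lift_t L Q t"
    using S\<xi> by (subst lift_S_eq_iff[OF S t LK c \<xi>K]) (auto simp: \<eta>_def)
  moreover have "(\<beta> $ i)\<^sup>2 = \<beta> $ i \<and> 0 \<le> \<beta> $ i \<and> 0 \<le> \<eta> $ i" if "i < L * Q" for i
    using \<beta>i[OF that] that by (auto simp: \<eta>_def)
  ultimately show ?thesis using c by auto
qed

text \<open>A direction that vanishes on the integer coordinates keeps them integral, so it may be added
  to a point of the uncertainty set arbitrarily often.\<close>
lemma recession_direction_zero:
  assumes S: "S \<in> carrier_mat J K" and ne: "uncertainty_set K L S t \<noteq> {}" and LK: "L \<le> K"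
    and bd: "\<forall>\<xi>\<in>uncertainty_set K L S t. norm_vec \<xi> \<le> D"
    and d: "d \<in> carrier_vec K" "\<forall>i<K. 0 \<le> d $ i" "S *\<^sub>v d = 0\<^sub>v J" "\<forall>l<L. d $ l = 0"
  shows "\<forall>i<K. d $ i = 0"
proof (intro allI impI)
  fix i assume i: "i < K"
  obtain \<xi> where \<xi>: "\<xi> \<in> uncertainty_set K L S t" using ne by blast
  then have \<xi>K: "\<xi> \<in> carrier_vec K" and \<xi>0: "\<forall>i<K. 0 \<le> \<xi> $ i" and S\<xi>: "S *\<^sub>v \<xi> = t"
    and int: "\<forall>l<L. \<xi> $ l \<in> \<int>"
    unfolding uncertainty_set_def by auto
  have t: "t \<in> carrier_vec J" using S S\<xi> \<xi>K by auto
  have bound: "real k * d $ i \<le> D" for k :: nat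
  proof -
    let ?\<zeta> = "\<xi> + real k \<cdot>\<^sub>v d"
    have "S *\<^sub>v ?\<zeta> = S *\<^sub>v \<xi> + real k \<cdot>\<^sub>v (S *\<^sub>v d)"
      using S \<xi>K d(1) by (simp add: mult_add_distrib_mat_vec[of _ J K] mult_mat_vec[of _ J K])
    also have "\<dots> = t" unfolding d(3) S\<xi> using t by (intro eq_vecI) auto
    finally have "?\<zeta> \<in> uncertainty_set K L S t"
      unfolding uncertainty_set_def using \<xi>K \<xi>0 int d LK by auto
    then have "norm_vec ?\<zeta> \<le> D" using bd by blast
    moreover have "\<bar>?\<zeta> $ i\<bar> \<le> norm_vec ?\<zeta>"
      using i \<xi>K d(1) by (intro abs_index_le_norm_vec) auto
    moreover have "?\<zeta> $ i = \<xi> $ i + real k * d $ i" using i \<xi>K d(1) by simp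
    ultimately show ?thesis using \<xi>0 i by (smt (verit))
  qed
  show "d $ i = 0"
  proof (rule ccontr)
    assume "d $ i \<noteq> 0"
    then have pos: "0 < d $ i" using d(2) i by (simp add: less_le)
    obtain k :: nat where "D / d $ i < real k" using reals_Archimedean2 by blast
    then show False using bound[of k] pos_divide_less_eq[OF pos, of D "real k"] by linarith
  qed
qed

text \<open>As \<open>\<beta> $ i + \<eta> $ i = s\<close>, complementarity leaves only 0 and
  \<open>s\<close> as values of \<open>\<beta> $ i\<close>; after division by \<open>s\<close> the
  digits are binary and the first \<open>L\<close> coordinates integral. The normalisation
  \<open>total\<close> is there to rule out \<open>s = 0\<close>.\<close>

lemma lifted_cone_point:
  assumes S: "S \<in> carrier_mat J K" and t: "t \<in> carrier_vec J" and LK: "L \<le> K"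
    and ne: "uncertainty_set K L S t \<noteq> {}"
    and bd: "\<forall>\<xi>\<in>uncertainty_set K L S t. norm_vec \<xi> \<le> D"
    and \<beta>: "\<beta> \<in> carrier_vec (L * Q)" and \<eta>: "\<eta> \<in> carrier_vec (L * Q)" and \<xi>: "\<xi> \<in> carrier_vec K"
    and \<beta>0: "\<forall>i<L * Q. 0 \<le> \<beta> $ i" and \<eta>0: "\<forall>i<L * Q. 0 \<le> \<eta> $ i" and \<xi>0: "\<forall>i<K. 0 \<le> \<xi> $ i"
    and s: "0 \<le> s"
    and eq: "lift_S J K L Q S *\<^sub>v (\<beta> @\<^sub>v \<eta> @\<^sub>v \<xi>) = s \<cdot>\<^sub>v lift_t L Q t"
    and total: "(\<Sum>i<L * Q + (L * Q + K). (\<beta> @\<^sub>v \<eta> @\<^sub>v \<xi>) $ i) + s = 1"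
    and compl: "\<forall>i<L * Q. \<beta> $ i * \<eta> $ i = 0"
  shows "0 < s \<and> (1 / s) \<cdot>\<^sub>v \<xi> \<in> uncertainty_set K L S t"
proof -
  have S\<xi>: "S *\<^sub>v \<xi> = s \<cdot>\<^sub>v t" and dig: "\<And>l. l < L \<Longrightarrow> \<xi> $ l = (\<Sum>q<Q. 2 ^ q * \<beta> $ (l * Q + q))"
    and sm: "\<And>i. i < L * Q \<Longrightarrow> \<beta> $ i + \<eta> $ i = s"
    using eq unfolding lift_S_eq_iff[OF S t LK \<beta> \<eta> \<xi>] by auto
  \<comment> \<open>For \<open>s = 0\<close> the digits and their complements vanish, which leaves
    \<open>\<xi>\<close> as a recession direction with zero integer coordinates. Boundedness makes
    it zero too, against \<open>total\<close>.\<close>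
  have "s \<noteq> 0"
  proof
    assume s0: "s = 0"
    have \<beta>\<eta>: "\<beta> $ i = 0 \<and> \<eta> $ i = 0" if "i < L * Q" for i
      using sm[OF that] \<beta>0 \<eta>0 that s0 by (simp add: add_nonneg_eq_0_iff)
    have "\<forall>l<L. \<xi> $ l = 0"
      using dig \<beta>\<eta> div_mod_less_mult(1) by (simp add: sum.neutral)
    moreover have "S *\<^sub>v \<xi> = 0\<^sub>v J" unfolding S\<xi> s0 using t by (intro eq_vecI) auto
    ultimately have "\<forall>i<K. \<xi> $ i = 0"
      using recession_direction_zero[OF S ne LK bd \<xi> \<xi>0] by blast
    then have "(\<beta> @\<^sub>v \<eta> @\<^sub>v \<xi>) $ i = 0" if "i < L * Q + (L * Q + K)" for i
      using that \<beta>\<eta> \<beta> \<eta> \<xi> by auto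
    then show False using total s0 by simp
  qed
  then have sp: "0 < s" using s by simp
  have \<beta>s: "\<beta> $ i / s \<in> \<int>" if "i < L * Q" for i
  proof -
    have "\<beta> $ i = 0 \<or> \<beta> $ i = s" using compl[rule_format, OF that] sm[OF that] by auto
    then show ?thesis using sp by auto
  qed
  have "\<xi> $ l / s \<in> \<int>" if "l < L" for l
  proof -
    have "\<xi> $ l / s = (\<Sum>q<Q. 2 ^ q * (\<beta> $ (l * Q + q) / s))"
      unfolding dig[OF that] by (simp add: sum_divide_distrib)
    also have "\<dots> \<in> \<int>"
      using that by (intro Ints_sum Ints_mult Ints_power \<beta>s div_mod_less_mult(1)) auto
    finally show ?thesis .
  qed
  moreover have "S *\<^sub>v ((1 / s) \<cdot>\<^sub>v \<xi>) = t"
    unfolding mult_mat_vec[OF S \<xi>] S\<xi> using sp by (intro eq_vecI) auto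
  ultimately have "(1 / s) \<cdot>\<^sub>v \<xi> \<in> uncertainty_set K L S t"
    unfolding uncertainty_set_def using \<xi> \<xi>0 sp LK by auto
  then show ?thesis using sp by blast
qed

subsection \<open>Duality\<close>

lemma robust_objective_eq: "robust_objective A b c \<xi> = (A *\<^sub>v \<xi>) \<bullet> (A *\<^sub>v \<xi>) + b \<bullet> \<xi> + c"
  by (simp add: robust_objective_def norm_vec_power2)

text \<open>Passes from the dimension in \<open>cop_feasible\<close> to the nested form used for
  splitting.\<close>

lemma lifted_dim: "2 * L * Q + K = L * Q + (L * Q + K)" for K L Q :: nat
  by simp

text \<open>The binary lift of \<open>\<xi>\<close> solves the lifted system with
  \<open>s = 1\<close>, so at this point the right-hand side of
  \<open>copositive_certificate_bound\<close> is the copositive objective without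
  \<open>c\<close>.\<close>

lemma copositive_weak_duality:
  assumes S: "S \<in> carrier_mat J K" and t: "t \<in> carrier_vec J" and LK: "L \<le> K"
    and A: "A \<in> carrier_mat M K" and b: "b \<in> carrier_vec K"
    and \<xi>: "\<xi> \<in> uncertainty_set K L S t" and Q: "\<forall>l<L. \<xi> $ l \<in> real ` {0..2 ^ Q - 1}"
    and y: "y \<in> cop_feasible J K L M Q S A b"
  shows "robust_objective A b c \<xi> \<le> cop_objective L Q t c y"
proof -
  obtain \<tau> \<psi> \<phi> \<gamma> H where yeq: "y = (\<tau>, \<psi>, \<phi>, \<gamma>, H)" by (cases y)
  note feas = y[unfolded yeq cop_feasible_def Let_def mem_Collect_eq prod.case lifted_dim]
  have \<xi>K: "\<xi> \<in> carrier_vec K" and \<xi>0: "\<forall>i<K. 0 \<le> \<xi> $ i"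
    using \<xi> unfolding uncertainty_set_def by auto
  obtain \<beta> \<eta> where \<beta>: "\<beta> \<in> carrier_vec (L * Q)" and \<eta>: "\<eta> \<in> carrier_vec (L * Q)"
    and eq: "lift_S J K L Q S *\<^sub>v (\<beta> @\<^sub>v \<eta> @\<^sub>v \<xi>) = lift_t L Q t"
    and bin: "\<forall>i<L * Q. (\<beta> $ i)\<^sup>2 = \<beta> $ i \<and> 0 \<le> \<beta> $ i \<and> 0 \<le> \<eta> $ i"
    using binary_lift_exists[OF S t LK \<xi> Q] by blast
  let ?z = "\<beta> @\<^sub>v \<eta> @\<^sub>v \<xi>"
  have z: "?z \<in> carrier_vec (L * Q + (L * Q + K))" using \<beta> \<eta> \<xi>K by (intro append_carrier_vec)
  have z0: "\<forall>i<L * Q + (L * Q + K). 0 \<le> ?z $ i"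
    using bin \<xi>0
    by (simp add: nonneg_append_iff[OF \<beta> append_carrier_vec[OF \<eta> \<xi>K]] nonneg_append_iff[OF \<eta> \<xi>K])
  have H: "H \<in> carrier_mat (L * Q + (L * Q + K)) (L * Q + (L * Q + K))"
    using feas unfolding psd_mat_def by blast
  have \<psi>: "\<psi> \<in> carrier_vec (L * Q + J + L)" and \<phi>: "\<phi> \<in> carrier_vec (L * Q + J + L)"
    and \<gamma>: "\<gamma> \<in> carrier_vec (L * Q)"
    using feas by blast+
  have "(lift_A M L Q A *\<^sub>v ?z) \<bullet> (lift_A M L Q A *\<^sub>v ?z) + lift_b L Q b \<bullet> ?z
    \<le> (lift_S J K L Q S *\<^sub>v ?z) \<bullet> \<psi> +
      hadamard_vec (lift_S J K L Q S *\<^sub>v ?z) (lift_S J K L Q S *\<^sub>v ?z) \<bullet> \<phi> + \<tau>"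
    using feas bin \<beta>
    by (intro copositive_certificate_bound[OF lift_S_carrier[OF S LK] lift_A_carrier[OF A]
          lift_b_carrier[OF b] \<psi> \<phi> \<gamma> H _ _ z z0]) auto
  then show ?thesis
    unfolding yeq eq lift_A_mult[OF A \<beta> \<eta> \<xi>K] lift_b_scalar_prod[OF b \<beta> \<eta> \<xi>K] robust_objective_eq
    by simp
qed

text \<open>Strictness of the bound \<open>v\<close> feeds the hypothesis \<open>pos\<close> of
  \<open>copositive_certificate_exists\<close>; the weights found there give a feasible point whose
  value is exactly \<open>v\<close>.\<close>

lemma copositive_feasible_attaining:
  assumes S: "S \<in> carrier_mat J K" and t: "t \<in> carrier_vec J" and LK: "L \<le> K"
    and A: "A \<in> carrier_mat M K" and b: "b \<in> carrier_vec K"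
    and ne: "uncertainty_set K L S t \<noteq> {}"
    and bd: "\<forall>\<xi>\<in>uncertainty_set K L S t. norm_vec \<xi> \<le> D"
    and v: "\<forall>\<xi>\<in>uncertainty_set K L S t. robust_objective A b c \<xi> < v"
  shows "\<exists>y\<in>cop_feasible J K L M Q S A b. cop_objective L Q t c y = v"
proof -
  \<comment> \<open>Only the digits \<open>\<beta>\<close> are penalised; \<open>\<eta>\<close> and
    \<open>\<xi>\<close> together form the remaining \<open>?k\<close> coordinates.\<close>
  let ?N = "L * Q" and ?k = "L * Q + K" and ?m = "L * Q + J + L"
  let ?R = "lift_S J K L Q S" and ?B = "lift_A M L Q A" and ?t = "lift_t L Q t" and ?b = "lift_b L Q b"
  have R: "?R \<in> carrier_mat ?m (?N + ?k)" by (rule lift_S_carrier[OF S LK])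
  have B: "?B \<in> carrier_mat M (?N + ?k)" by (rule lift_A_carrier[OF A])
  have tb: "?t \<in> carrier_vec ?m" by (rule lift_t_carrier[OF t])
  have bb: "?b \<in> carrier_vec (?N + ?k)" by (rule lift_b_carrier[OF b])
  \<comment> \<open>On the cone the lifted system gives \<open>s = \<beta> $ i + \<eta> $ i\<close>,
    which turns the digit penalty into the product \<open>\<beta> $ i * \<eta> $ i\<close> of
    nonnegative numbers.\<close>
  have split: "\<exists>\<beta> \<eta> \<xi>. \<beta> \<in> carrier_vec ?N \<and> \<eta> \<in> carrier_vec ?N \<and> \<xi> \<in> carrier_vec K \<and> z = \<beta> @\<^sub>v \<eta> @\<^sub>v \<xi> \<and>
      (\<forall>i<?N. 0 \<le> \<beta> $ i) \<and> (\<forall>i<?N. 0 \<le> \<eta> $ i) \<and> (\<forall>i<K. 0 \<le> \<xi> $ i) \<and>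
      (\<forall>i<?N. s * z $ i - (z $ i)\<^sup>2 = \<beta> $ i * \<eta> $ i)"
    if z: "z \<in> carrier_vec (?N + ?k)" "\<forall>i<?N + ?k. 0 \<le> z $ i" "?R *\<^sub>v z = s \<cdot>\<^sub>v ?t" for z s
  proof -
    obtain \<beta> z' where 1: "\<beta> \<in> carrier_vec ?N" "z' \<in> carrier_vec ?k" "z = \<beta> @\<^sub>v z'"
      using z(1) by (rule split_vec)
    obtain \<eta> \<xi> where 2: "\<eta> \<in> carrier_vec ?N" "\<xi> \<in> carrier_vec K" "z' = \<eta> @\<^sub>v \<xi>"
      using 1(2) by (rule split_vec)
    have zi: "z $ i = \<beta> $ i" if "i < ?N" for i
      using 1 that by simp
    have s: "s = \<beta> $ i + \<eta> $ i" if "i < ?N" for i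
      using z(3) that unfolding 1(3) 2(3) lift_S_eq_iff[OF S t LK 1(1) 2(1,2)] by simp
    have "s * z $ i - (z $ i)\<^sup>2 = \<beta> $ i * \<eta> $ i" if "i < ?N" for i
      unfolding zi[OF that] s[OF that] by (simp add: power2_eq_square algebra_simps)
    moreover have "(\<forall>i<?N. 0 \<le> \<beta> $ i) \<and> (\<forall>i<?N. 0 \<le> \<eta> $ i) \<and> (\<forall>i<K. 0 \<le> \<xi> $ i)"
      using z(2)
      by (simp only: 1(3) nonneg_append_iff[OF 1(1,2)]) (simp only: 2(3) nonneg_append_iff[OF 2(1,2)])
    moreover have "z = \<beta> @\<^sub>v \<eta> @\<^sub>v \<xi>" using 1(3) 2(3) by simp
    ultimately show ?thesis
      using 1(1) 2(1,2) by (intro exI[of _ \<beta>] exI[of _ \<eta>] exI[of _ \<xi>]) simp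
  qed
  have "\<exists>\<rho> \<mu>. copositive_mat ((?N + ?k) + 1)
      (four_block_mat
        (transpose_mat ?R * diag_of_vec (\<rho> \<cdot>\<^sub>v ones_vec ?m) * ?R - transpose_mat ?B * ?B
          - diag_of_vec ((\<mu> \<cdot>\<^sub>v ones_vec ?N) @\<^sub>v 0\<^sub>v ?k))
        (transpose_mat (mat_of_row ((1/2) \<cdot>\<^sub>v
          (transpose_mat ?R *\<^sub>v ((- 2 * \<rho>) \<cdot>\<^sub>v ?t) - ?b + ((\<mu> \<cdot>\<^sub>v ones_vec ?N) @\<^sub>v 0\<^sub>v ?k)))))
        (mat_of_row ((1/2) \<cdot>\<^sub>v
          (transpose_mat ?R *\<^sub>v ((- 2 * \<rho>) \<cdot>\<^sub>v ?t) - ?b + ((\<mu> \<cdot>\<^sub>v ones_vec ?N) @\<^sub>v 0\<^sub>v ?k))))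
        (Matrix.mat 1 1 (\<lambda>_. (v - c) + \<rho> * (?t \<bullet> ?t))))"
  \<comment> \<open>The constant \<open>c\<close> is absorbed by taking \<open>v - c\<close> as the
    bound.\<close>
  proof (rule copositive_certificate_exists[OF R B tb bb])
    fix z s assume z: "z \<in> carrier_vec (?N + ?k)" "\<forall>i<?N + ?k. 0 \<le> z $ i" and s: "0 \<le> s"
      and eq: "?R *\<^sub>v z = s \<cdot>\<^sub>v ?t"
    obtain \<beta> \<eta> \<xi> where \<beta>: "\<beta> \<in> carrier_vec ?N" and \<eta>: "\<eta> \<in> carrier_vec ?N" and \<xi>: "\<xi> \<in> carrier_vec K"
      and zeq: "z = \<beta> @\<^sub>v \<eta> @\<^sub>v \<xi>" and \<beta>0: "\<forall>i<?N. 0 \<le> \<beta> $ i" and \<eta>0: "\<forall>i<?N. 0 \<le> \<eta> $ i"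
      and \<xi>0: "\<forall>i<K. 0 \<le> \<xi> $ i" and p: "\<forall>i<?N. s * z $ i - (z $ i)\<^sup>2 = \<beta> $ i * \<eta> $ i"
      using split[OF z eq] by blast
    have psum: "(\<Sum>i<?N. s * z $ i - (z $ i)\<^sup>2) = (\<Sum>i<?N. \<beta> $ i * \<eta> $ i)"
      using p by (intro sum.cong) auto
    show "0 \<le> (\<Sum>i<?N. s * z $ i - (z $ i)\<^sup>2)"
      unfolding psum using \<beta>0 \<eta>0 by (intro sum_nonneg) auto
    assume total: "(\<Sum>i<?N + ?k. z $ i) + s = 1" and "(\<Sum>i<?N. s * z $ i - (z $ i)\<^sup>2) = 0"
    then have compl: "\<forall>i<?N. \<beta> $ i * \<eta> $ i = 0"
      unfolding psum using \<beta>0 \<eta>0 by (subst (asm) sum_nonneg_eq_0_iff) auto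
    have sp: "0 < s" and in_\<Xi>: "(1 / s) \<cdot>\<^sub>v \<xi> \<in> uncertainty_set K L S t"
      using lifted_cone_point[OF S t LK ne bd \<beta> \<eta> \<xi> \<beta>0 \<eta>0 \<xi>0 s eq[unfolded zeq] total[unfolded zeq] compl]
      by auto
    have A\<xi>: "A *\<^sub>v \<xi> \<in> carrier_vec M" using A \<xi> by auto
    have "robust_objective A b c ((1 / s) \<cdot>\<^sub>v \<xi>) < v" using v in_\<Xi> by blast
    then have "(1 / s) * ((1 / s) * ((A *\<^sub>v \<xi>) \<bullet> (A *\<^sub>v \<xi>))) + (1 / s) * (b \<bullet> \<xi>) + c < v"
      unfolding robust_objective_eq mult_mat_vec[OF A \<xi>] using A\<xi> b \<xi> by simp
    \<comment> \<open>Multiplication by \<open>s\<^sup>2\<close> returns from the scaled point of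
      the uncertainty set to the cone.\<close>
    then have "s\<^sup>2 * ((1 / s) * ((1 / s) * ((A *\<^sub>v \<xi>) \<bullet> (A *\<^sub>v \<xi>))) + (1 / s) * (b \<bullet> \<xi>)) < s\<^sup>2 * (v - c)"
      using sp by (intro mult_strict_left_mono) auto
    then have "(A *\<^sub>v \<xi>) \<bullet> (A *\<^sub>v \<xi>) + s * (b \<bullet> \<xi>) < (v - c) * s\<^sup>2"
      using sp by (simp add: power2_eq_square algebra_simps)
    then show "(?B *\<^sub>v z) \<bullet> (?B *\<^sub>v z) + s * (?b \<bullet> z) < (v - c) * s\<^sup>2"
      unfolding zeq lift_A_mult[OF A \<beta> \<eta> \<xi>] lift_b_scalar_prod[OF b \<beta> \<eta> \<xi>] .
  qed
  then obtain \<rho> \<mu> where cop: "copositive_mat ((?N + ?k) + 1)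
      (four_block_mat
        (transpose_mat ?R * diag_of_vec (\<rho> \<cdot>\<^sub>v ones_vec ?m) * ?R - transpose_mat ?B * ?B
          - diag_of_vec ((\<mu> \<cdot>\<^sub>v ones_vec ?N) @\<^sub>v 0\<^sub>v ?k))
        (transpose_mat (mat_of_row ((1/2) \<cdot>\<^sub>v
          (transpose_mat ?R *\<^sub>v ((- 2 * \<rho>) \<cdot>\<^sub>v ?t) - ?b + ((\<mu> \<cdot>\<^sub>v ones_vec ?N) @\<^sub>v 0\<^sub>v ?k)))))
        (mat_of_row ((1/2) \<cdot>\<^sub>v
          (transpose_mat ?R *\<^sub>v ((- 2 * \<rho>) \<cdot>\<^sub>v ?t) - ?b + ((\<mu> \<cdot>\<^sub>v ones_vec ?N) @\<^sub>v 0\<^sub>v ?k))))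
        (Matrix.mat 1 1 (\<lambda>_. (v - c) + \<rho> * (?t \<bullet> ?t))))"
    by blast
  let ?\<psi> = "(- 2 * \<rho>) \<cdot>\<^sub>v ?t" and ?\<phi> = "\<rho> \<cdot>\<^sub>v ones_vec ?m" and ?\<gamma> = "\<mu> \<cdot>\<^sub>v ones_vec ?N"
  have \<phi>: "?\<phi> \<in> carrier_vec ?m" and \<psi>: "?\<psi> \<in> carrier_vec ?m" and \<gamma>: "?\<gamma> \<in> carrier_vec ?N"
    using tb by (auto simp: ones_vec_def)
  let ?y = "((v - c) + \<rho> * (?t \<bullet> ?t), ?\<psi>, ?\<phi>, ?\<gamma>, transpose_mat ?B * ?B)"
  have "?y \<in> cop_feasible J K L M Q S A b"
    unfolding cop_feasible_def Let_def mem_Collect_eq prod.case lifted_dim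
    using \<phi> \<psi> \<gamma> psd_gram[OF B] cop by blast
  moreover have "hadamard_vec ?t ?t \<bullet> ?\<phi> = \<rho> * (?t \<bullet> ?t)"
    unfolding hadamard_scalar_prod[OF tb \<phi>] scalar_prod_eq_sum[OF tb]
    by (simp add: ones_vec_def sum_distrib_left power2_eq_square)
  \<comment> \<open>The shares of \<open>\<psi>\<close>, \<open>\<phi>\<close> and
    \<open>\<tau>\<close> contain \<open>- 2 * \<rho>\<close>, \<open>\<rho>\<close> and
    \<open>\<rho>\<close> times \<open>?t \<bullet> ?t\<close>, which cancel and leave
    \<open>v\<close>.\<close>
  then have "cop_objective L Q t c ?y = v"
    using tb by simp
  ultimately show ?thesis by blast
qed

text \<open>Weak duality gives one inequality. For the other, every real number above the supremum
  is the value of a feasible point, so the infimum cannot exceed the supremum; attainment is not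
  claimed.\<close>

lemma copositive_INF_eq_robust_SUP:
  assumes S: "S \<in> carrier_mat J K" and t: "t \<in> carrier_vec J" and LK: "L \<le> K"
    and A: "A \<in> carrier_mat M K" and b: "b \<in> carrier_vec K"
    and ne: "uncertainty_set K L S t \<noteq> {}"
    and bd: "\<forall>\<xi>\<in>uncertainty_set K L S t. norm_vec \<xi> \<le> D"
    and Q: "\<forall>\<xi>\<in>uncertainty_set K L S t. \<forall>l<L. \<xi> $ l \<in> real ` {0..2 ^ Q - 1}"
  shows "(INF y \<in> cop_feasible J K L M Q S A b. ereal (cop_objective L Q t c y))
    = (SUP \<xi>\<in>uncertainty_set K L S t. ereal (robust_objective A b c \<xi>))" (is "?I = ?S")
proof (rule antisym)
  show "?S \<le> ?I"
    using copositive_weak_duality[OF S t LK A b] Q by (intro SUP_least INF_greatest) auto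
  show "?I \<le> ?S"
  proof (rule dense_ge)
    fix e assume e: "?S < e"
    show "?I \<le> e"
    \<comment> \<open>Only a real \<open>e\<close> needs an argument: infinity bounds everything
      from above, and minus infinity cannot lie above \<open>?S\<close>.\<close>
    proof (cases e)
      case (real v)
      have "robust_objective A b c \<xi> < v" if "\<xi> \<in> uncertainty_set K L S t" for \<xi>
        using SUP_upper[OF that, of "\<lambda>\<xi>. ereal (robust_objective A b c \<xi>)"] e real
        by (metis ereal_less_eq(3) less_ereal.simps(1) order_le_less_trans)
      then obtain y where "y \<in> cop_feasible J K L M Q S A b" "cop_objective L Q t c y = v"
        using copositive_feasible_attaining[OF S t LK A b ne bd] by blast
      then show ?thesis using real INF_lower by force
    qed (use e in auto)
  qed
qed

theorem theorem3:
  fixes X :: "(real^'d) set"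
    and A :: "real^'d \<Rightarrow> real mat" and b :: "real^'d \<Rightarrow> real vec" and c :: "real^'d \<Rightarrow> real"
    and S :: "real mat" and t :: "real vec" and \<Xi> :: "real vec set"
    and J K L M Q :: nat
  assumes "polytope X"
    and "affine_mat_on X M K A"
    and "affine_vec_on X K b"
    and "quadratic_fun_on X c" and "convex_on X c"
    and "S \<in> carrier_mat J K" and "t \<in> carrier_vec J" and "L \<le> K"
    and "\<Xi> = uncertainty_set K L S t"
    and "\<Xi> \<noteq> {}"
    and "\<exists>B. \<forall>\<xi>\<in>\<Xi>. norm_vec \<xi> \<le> B"
    and "\<forall>\<xi>\<in>\<Xi>. \<forall>l<L. \<xi> $ l \<in> real ` {0..2 ^ Q - 1}"
  shows "(\<forall>x\<in>X.
            (INF y \<in> cop_feasible J K L M Q S (A x) (b x). ereal (cop_objective L Q t (c x) y))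
            = (SUP \<xi>\<in>\<Xi>. ereal (robust_objective (A x) (b x) (c x) \<xi>))) \<and>
         (INF x\<in>X. SUP \<xi>\<in>\<Xi>. ereal (robust_objective (A x) (b x) (c x) \<xi>))
         = (INF (x, y) \<in> (SIGMA x:X. cop_feasible J K L M Q S (A x) (b x)).
              ereal (cop_objective L Q t (c x) y))"
proof -
  let ?I = "\<lambda>x. INF y \<in> cop_feasible J K L M Q S (A x) (b x). ereal (cop_objective L Q t (c x) y)"
  let ?S = "\<lambda>x. SUP \<xi>\<in>\<Xi>. ereal (robust_objective (A x) (b x) (c x) \<xi>)"
  have pointwise: "?I x = ?S x" if x: "x \<in> X" for x
  proof -
    have "A x \<in> carrier_mat M K" "b x \<in> carrier_vec K"
      using assms(2,3) x unfolding affine_mat_on_def affine_vec_on_def by blast+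
    then show ?thesis
      using copositive_INF_eq_robust_SUP[OF assms(6-8), of "A x" M "b x"] assms(9-12) by blast
  qed
  moreover have "(INF x\<in>X. ?S x) = (INF x\<in>X. ?I x)"
    using pointwise by simp
  \<comment> \<open>An infimum over pairs is an iterated infimum; in \<open>ereal\<close> an empty
    \<open>X\<close> gives infinity on both sides.\<close>
  moreover have "(INF x\<in>X. ?I x) = (INF (x, y) \<in> (SIGMA x:X. cop_feasible J K L M Q S (A x) (b x)).
      ereal (cop_objective L Q t (c x) y))"
    by (intro antisym INF_greatest) (auto intro!: INF_greatest INF_lower2)
  ultimately show ?thesis by simp
qed

end
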